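(* Fix integers $d \geq 2$ and $D \geq 1$. Let $K/\mathbb{Q}$ be a number field of degree $D$, let $\mathfrak{p}$ be a (nonzero) prime of the ring of integers $\mathcal{O}_K$, and let $\phi = \sum_{i=0}^d a_i X^i \in K[X]$ be a polynomial with inseparable good reduction at $\mathfrak{p}$. Then $$\#\mathrm{Per}_K(\phi) \leq \mathrm{N}_{K/\mathbb{Q}}(\mathfrak{p}),$$ where $\mathrm{N}_{K/\mathbb{Q}}(\mathfrak{p})$ is the ideal norm of $\mathfrak{p}$. In particular, $\#\mathrm{Per}_K(\phi) \leq d^D$.
   Context: For a polynomial $\phi \in K[X]$, write $\phi^n$ for the $n$-fold composition of $\phi$ with itself, and let $\mathrm{Per}_K(\phi) = \{x \in K \mid \phi^n(x) = x \text{ for some positive integer } n\}$. Let $v_{\mathfrak{p}}$ denote the $\mathfrak{p}$-adic valuation on $K$. The polynomial $\phi = \sum_{i=0}^d a_i X^i \in K[X]$ has good reduction at $\mathfrak{p}$ if $v_{\mathfrak{p}}(a_i) \geq 0$ for all $i$ and $v_{\mathfrak{p}}(a_d) = 0$. It has inseparable good reduction at $\mathfrak{p}$ if it has good reduction at $\mathfrak{p}$ and moreover $v_{\mathfrak{p}}(a_i) > 0$ for every index $i \in \{0, \dots, d\}$ that is coprime to $\mathfrak{p}$ (i.e. every $i$ not divisible by the rational prime $p$ lying below $\mathfrak{p}$). *)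

theory Defs
  imports
    "HOL-Algebra.QuotRing"
    "HOL-Algebra.Ideal_Product"
    "HOL-Computational_Algebra.Polynomial"
    "HOL-Computational_Algebra.Primes"
    "HOL-Library.Extended"
begin

text \<open>
  A number field is a type of class \<open>field_char_0\<close> that is finite-dimensional as a vector space
  over the rationals; the scalar action is multiplication by the image of \<open>of_rat\<close>.
\<close>

definition number_field_of_degree :: "'k::field_char_0 itself \<Rightarrow> nat \<Rightarrow> bool" where
  "number_field_of_degree _ D \<longleftrightarrow>
     (\<exists>B :: 'k set. finite_dimensional_vector_space (\<lambda>(q::rat) (x::'k). of_rat q * x) B \<and> card B = D)"

definition ring_of_integers :: "'k::field_char_0 ring" where
  "ring_of_integers =
     \<lparr> carrier = {x. algebraic_int x}, monoid.mult = (*), one = 1, zero = 0, add = (+) \<rparr>"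

definition ideal_norm :: "'k::field_char_0 set \<Rightarrow> nat" where
  "ideal_norm I = card (carrier (ring_of_integers Quot I))"

text \<open>
  The multiplicity of \<open>P\<close> in the principal ideal generated by \<open>x\<close>; meaningful for nonzero
  algebraic integers \<open>x\<close>. The power is taken in the semiring of ideals of the ring of integers.
\<close>

definition ideal_multiplicity :: "'k::field_char_0 set \<Rightarrow> 'k \<Rightarrow> nat" where
  "ideal_multiplicity P x =
     (GREATEST n. x \<in> P [^]\<^bsub>ideals_set (ring_of_integers :: 'k ring)\<^esub> (n::nat))"

text \<open>
  The normalized \<open>P\<close>-adic valuation: the multiplicity of the numerator minus that of the
  denominator for any representation as a fraction of algebraic integers, and \<open>\<infinity>\<close> at \<open>0\<close>.
\<close>

definition valuation :: "'k::field_char_0 set \<Rightarrow> 'k \<Rightarrow> int extended" where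
  "valuation P x =
     (if x = 0 then Pinf
      else Fin (THE m. \<exists>a b. algebraic_int a \<and> algebraic_int b \<and> b \<noteq> 0 \<and> x = a / b \<and>
                  m = int (ideal_multiplicity P a) - int (ideal_multiplicity P b)))"

definition prime_below :: "'k::field_char_0 set \<Rightarrow> nat" where
  "prime_below P = (THE p. Factorial_Ring.prime p \<and> of_nat p \<in> P)"

definition good_reduction :: "'k::field_char_0 set \<Rightarrow> 'k poly \<Rightarrow> bool" where
  "good_reduction P \<phi> \<longleftrightarrow>
     (\<forall>i \<le> Polynomial.degree \<phi>. valuation P (Polynomial.coeff \<phi> i) \<ge> 0) \<and>
     valuation P (Polynomial.coeff \<phi> (Polynomial.degree \<phi>)) = 0"

definition inseparable_good_reduction :: "'k::field_char_0 set \<Rightarrow> 'k poly \<Rightarrow> bool" where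
  "inseparable_good_reduction P \<phi> \<longleftrightarrow>
     good_reduction P \<phi> \<and>
     (\<forall>i \<le> Polynomial.degree \<phi>. \<not> prime_below P dvd i \<longrightarrow>
        valuation P (Polynomial.coeff \<phi> i) > 0)"

definition Per :: "'k::field_char_0 poly \<Rightarrow> 'k set" where
  "Per \<phi> = {x. \<exists>n>0. (poly \<phi> ^^ n) x = x}"

end

theory Submission
  imports Defs
begin

text \<open>
  Let \<open>R\<close> be the local ring of \<open>P\<close> inside \<open>K\<close> and \<open>M\<close> its maximal ideal. Good reduction means
  that \<open>\<phi>\<close> has coefficients in \<open>R\<close> and a unit as leading coefficient. Outside \<open>R\<close> the leading
  term dominates, so \<open>\<phi>\<close> makes \<open>1/x\<close> strictly more divisible and no such point returns: every
  periodic point lies in \<open>R\<close> (\<open>periodic_integral\<close>). Inseparability means that the derivative of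
  \<open>\<phi>\<close> vanishes modulo \<open>M\<close>, so on each residue class \<open>\<phi>\<close> is a strict contraction:
  \<open>\<phi>(x) - \<phi>(y)\<close> is \<open>x - y\<close> times an element of \<open>M\<close>. Two periodic points in one class have a
  common period, and a strict contraction cannot bring their difference back to itself unless it is
  zero (\<open>periodic_congruent_imp_eq\<close>). Hence the periodic points inject into \<open>R/M\<close>, which is
  \<open>O/P\<close>, where \<open>O\<close> is the ring of algebraic integers of \<open>K\<close>.

  For the second bound, the leading coefficient is a unit, so inseparability forces the residue
  characteristic \<open>p\<close> to divide \<open>d\<close>, whence \<open>p \<le> d\<close>. Any \<open>D + 1\<close> elements of \<open>K\<close> satisfy a
  primitive integer relation, which survives modulo \<open>p\<close>; so \<open>O/P\<close> has dimension at most \<open>D\<close>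
  over the field with \<open>p\<close> elements (\<open>residues_bound\<close>).

  The valuation is defined through powers of \<open>P\<close>, so it has to be shown that it is the one with
  valuation ring \<open>R\<close>, that is, that \<open>P\<close> becomes principal in \<open>R\<close>. This comes from the finiteness
  of \<open>O/pO\<close> and the pigeonhole principle. They give an element \<open>b\<close> with \<open>bP \<subseteq> pO\<close> and
  \<open>b \<notin> pO\<close>. If \<open>c = b/p\<close> mapped \<open>P\<close> into itself, all \<open>p c\<^sup>n\<close> would be integral, two of them
  would agree modulo \<open>pO\<close>, and \<open>c\<close> would be a root of a monic polynomial \<open>X\<^sup>j - X\<^sup>i - w\<close> with
  \<open>w\<close> integral, contradicting \<open>c \<notin> O\<close>. So \<open>s = c u \<notin> P\<close> for some \<open>u \<in> P\<close>, and then
  \<open>s P \<subseteq> u O\<close>: \<open>u\<close> generates \<open>P\<close> locally (\<open>ex_local_generator\<close>).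
\<close>

section \<open>Periodic points over a valuation ring\<close>

text \<open>
  The dynamical argument is about divisibility alone, so it is stated for a valuation ring \<open>R\<close> of
  a field with maximal ideal \<open>M\<close>: membership in \<open>R\<close> and \<open>M\<close> stands for valuation \<open>\<ge> 0\<close> and \<open>> 0\<close>.
\<close>

locale valuation_subring =
  fixes R M :: "'k::field set"
  assumes one_mem: "1 \<in> R"
    and add_mem: "x \<in> R \<Longrightarrow> y \<in> R \<Longrightarrow> x + y \<in> R"
    and minus_mem: "x \<in> R \<Longrightarrow> - x \<in> R"
    and mult_mem: "x \<in> R \<Longrightarrow> y \<in> R \<Longrightarrow> x * y \<in> R"
    and max_subset: "M \<subseteq> R"
    and max_zero: "0 \<in> M"
    and max_add: "x \<in> M \<Longrightarrow> y \<in> M \<Longrightarrow> x + y \<in> M"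
    and max_mult: "x \<in> M \<Longrightarrow> y \<in> R \<Longrightarrow> x * y \<in> M"
    and one_notin_max: "1 \<notin> M"
    and inverse_mem: "x \<in> R \<Longrightarrow> x \<notin> M \<Longrightarrow> inverse x \<in> R"
    and inverse_mem_max: "x \<notin> R \<Longrightarrow> inverse x \<in> M"
begin

lemma zero_mem: "0 \<in> R"
  using max_zero max_subset by auto

lemma max_minus: "x \<in> M \<Longrightarrow> - x \<in> M"
  using max_mult[OF _ minus_mem[OF one_mem]] by simp

lemma max_mult2: "y \<in> R \<Longrightarrow> x \<in> M \<Longrightarrow> y * x \<in> M"
  using max_mult by (simp add: mult.commute)

lemma power_mem: "x \<in> R \<Longrightarrow> x ^ n \<in> R"
  by (induction n) (auto intro: one_mem mult_mem)

lemma sum_mem: "(\<And>i. i \<in> A \<Longrightarrow> f i \<in> R) \<Longrightarrow> sum f A \<in> R"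
  by (induction A rule: infinite_finite_induct) (auto intro: zero_mem add_mem)

lemma max_sum: "(\<And>i. i \<in> A \<Longrightarrow> f i \<in> M) \<Longrightarrow> sum f A \<in> M"
  by (induction A rule: infinite_finite_induct) (auto intro: max_zero max_add)

lemma unit_mult:
  assumes "x \<in> R - M" "y \<in> R - M"
  shows "x * y \<in> R - M"
proof
  show "x * y \<in> R" using assms mult_mem by auto
  show "x * y \<notin> M"
  proof
    assume "x * y \<in> M"
    moreover have "inverse x \<in> R" "x \<noteq> 0" using assms inverse_mem max_zero by auto
    ultimately have "inverse x * (x * y) \<in> M" by (metis max_mult2)
    moreover have "inverse x * (x * y) = y" using \<open>x \<noteq> 0\<close> by simp
    ultimately show False using assms by simp
  qed
qed

lemma unit_inverse:
  assumes "x \<in> R - M"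
  shows "inverse x \<in> R - M"
proof
  show "inverse x \<in> R" using assms inverse_mem by auto
  show "inverse x \<notin> M"
  proof
    assume "inverse x \<in> M"
    then have "x * inverse x \<in> M" using assms by (intro max_mult2) auto
    moreover have "x \<noteq> 0" using assms max_zero by auto
    ultimately show False using one_notin_max by simp
  qed
qed

lemma unit_add_max:
  assumes "x \<in> R - M" "y \<in> M"
  shows "x + y \<in> R - M"
proof -
  have "x + y \<notin> M"
    using assms max_add[of "x + y" "- y"] max_minus by auto
  then show ?thesis using assms add_mem max_subset by auto
qed

end

text \<open>
  The condition on the elements \<open>i a\<^sub>i\<close> says that the derivative of \<open>\<phi>\<close> vanishes modulo \<open>M\<close>.
  It covers both kinds of index in inseparable good reduction: if the residue characteristic
  divides \<open>i\<close> the factor \<open>i\<close> lies in \<open>M\<close>, otherwise \<open>a\<^sub>i\<close> does.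
\<close>

locale inseparable_polynomial = valuation_subring R M for R M :: "'k::field_char_0 set" +
  fixes \<phi> :: "'k poly"
  assumes coeff_mem: "coeff \<phi> i \<in> R"
    and lead_coeff_unit: "lead_coeff \<phi> \<notin> M"
    and deriv_coeff_mem: "of_nat i * coeff \<phi> i \<in> M"
    and degree_ge2: "degree \<phi> \<ge> 2"
begin

lemma poly_mem: "x \<in> R \<Longrightarrow> poly \<phi> x \<in> R"
  by (auto simp: poly_altdef intro!: sum_mem mult_mem power_mem coeff_mem)

lemma iterate_mem: "x \<in> R \<Longrightarrow> (poly \<phi> ^^ n) x \<in> R"
  by (induction n) (auto intro: poly_mem)

text \<open>
  For \<open>x \<notin> R\<close> all lower terms are small compared with the leading one: \<open>\<phi>(x)\<close> is a unit times
  \<open>x\<^sup>d\<close>. As \<open>d \<ge> 2\<close>, its inverse is divisible by \<open>1/x\<close> with a quotient in \<open>M\<close>.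
\<close>

lemma inverse_poly_nonintegral:
  assumes "x \<notin> R"
  shows "\<exists>m\<in>M. inverse (poly \<phi> x) = inverse x * m" and "poly \<phi> x \<notin> R"
proof -
  let ?d = "degree \<phi>"
  \<comment> \<open>\<open>w\<close> is \<open>\<phi>(x) / x\<^sup>d\<close>, which reduces to the leading coefficient modulo \<open>M\<close>.\<close>
  define w where "w = lead_coeff \<phi> + (\<Sum>i<?d. coeff \<phi> i * inverse x ^ (?d - i))"
  have x0: "x \<noteq> 0" using assms zero_mem by auto
  have ix: "inverse x \<in> M" using assms inverse_mem_max by auto
  have "coeff \<phi> i * inverse x ^ (?d - i) \<in> M" if "i < ?d" for i
  proof -
    from that obtain k where "?d - i = Suc k" by (metis Suc_diff_Suc)
    then show ?thesis using ix max_subset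
      by (auto intro!: max_mult2[OF coeff_mem] max_mult power_mem)
  qed
  then have w: "w \<in> R - M" unfolding w_def
    by (intro unit_add_max max_sum) (use lead_coeff_unit coeff_mem in auto)
  have "x ^ ?d * (coeff \<phi> i * inverse x ^ (?d - i)) = coeff \<phi> i * x ^ i" if "i < ?d" for i
  proof -
    have "x ^ ?d = x ^ i * x ^ (?d - i)" using that by (simp flip: power_add)
    then show ?thesis using x0 by (simp add: power_inverse)
  qed
  then have "(\<Sum>i<?d. x ^ ?d * (coeff \<phi> i * inverse x ^ (?d - i))) = (\<Sum>i<?d. coeff \<phi> i * x ^ i)"
    by (intro sum.cong) auto
  then have pw: "poly \<phi> x = x ^ ?d * w"
    by (simp add: w_def poly_altdef distrib_left sum_distrib_left lessThan_Suc_atMost[symmetric])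
  obtain k where k: "?d = Suc (Suc k)" using degree_ge2 by (metis add_2_eq_Suc le_Suc_ex)
  \<comment> \<open>The quotient is \<open>x\<^sup>1\<^sup>-\<^sup>d / w\<close>, and the exponent \<open>d - 1 = Suc k\<close> leaves a factor \<open>1/x\<close> in \<open>M\<close>.\<close>
  let ?m = "inverse x * (inverse x ^ k * inverse w)"
  have "?m \<in> M"
    using ix max_subset unit_inverse[OF w] by (intro max_mult mult_mem power_mem) auto
  moreover have eq: "inverse (poly \<phi> x) = inverse x * ?m"
    by (simp add: pw k power_inverse mult_ac)
  ultimately show "\<exists>m\<in>M. inverse (poly \<phi> x) = inverse x * m" by blast
  show "poly \<phi> x \<notin> R"
  proof
    assume "poly \<phi> x \<in> R"
    moreover have "inverse (poly \<phi> x) \<in> M"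
      unfolding eq using ix \<open>?m \<in> M\<close> max_subset max_mult by auto
    ultimately have "poly \<phi> x * inverse (poly \<phi> x) \<in> M" by (intro max_mult2)
    moreover have "poly \<phi> x \<noteq> 0" using pw x0 w max_zero by auto
    ultimately show False using one_notin_max by simp
  qed
qed

lemma iterate_nonintegral:
  assumes "x \<notin> R" "n > 0"
  shows "(poly \<phi> ^^ n) x \<notin> R \<and> (\<exists>m\<in>M. inverse ((poly \<phi> ^^ n) x) = inverse x * m)"
  using \<open>n > 0\<close>
proof (induction n rule: nat_induct_non_zero)
  case 1
  then show ?case using inverse_poly_nonintegral[OF assms(1)] by simp
next
  case (Suc n)
  then obtain m where m: "m \<in> M" "inverse ((poly \<phi> ^^ n) x) = inverse x * m" by auto
  from Suc obtain m' where "m' \<in> M" "inverse ((poly \<phi> ^^ Suc n) x) = inverse x * (m * m')"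
    using inverse_poly_nonintegral(1)[of "(poly \<phi> ^^ n) x"] m by (auto simp: mult.assoc)
  then show ?case
    using Suc inverse_poly_nonintegral(2)[of "(poly \<phi> ^^ n) x"] m max_mult max_subset by auto
qed

text \<open>
  Along the orbit of a point outside \<open>R\<close> the inverse picks up factors from \<open>M\<close>; a return to the
  starting point would make such a factor equal to \<open>1\<close>.
\<close>

lemma periodic_integral:
  assumes "x \<in> Per \<phi>"
  shows "x \<in> R"
proof (rule ccontr)
  assume x: "x \<notin> R"
  from assms obtain n where n: "n > 0" "(poly \<phi> ^^ n) x = x" by (auto simp: Per_def)
  with iterate_nonintegral[OF x n(1)] obtain m where "m \<in> M" "inverse x = inverse x * m" by auto
  moreover have "x \<noteq> 0" using x zero_mem by auto
  ultimately show False using one_notin_max by simp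
qed

text \<open>
  The quotient \<open>(x\<^sup>i - y\<^sup>i) / (x - y)\<close> is congruent to the derivative \<open>i x\<^sup>i\<^sup>-\<^sup>1\<close> modulo \<open>M\<close>.
  Stating it with a factor \<open>q\<close> avoids dividing by \<open>x - y\<close>, which may vanish.
\<close>

lemma power_diff_factor:
  assumes "x \<in> R" "y \<in> R" "x - y \<in> M"
  shows "\<exists>q. q - of_nat i * x ^ (i - 1) \<in> M \<and> x ^ i - y ^ i = (x - y) * q"
proof (induction i)
  case 0
  then show ?case by (intro exI[of _ 0]) (auto simp: max_zero)
next
  case (Suc i)
  then obtain q where q: "q - of_nat i * x ^ (i - 1) \<in> M" "x ^ i - y ^ i = (x - y) * q" by blast
  have qR: "q \<in> R"
  proof -
    have "of_nat i \<in> R" by (induction i) (auto intro: zero_mem add_mem one_mem)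
    then have "of_nat i * x ^ (i - 1) \<in> R" using assms by (intro mult_mem power_mem)
    then show ?thesis using add_mem[of "q - of_nat i * x ^ (i - 1)" "of_nat i * x ^ (i - 1)"]
        q(1) max_subset by auto
  qed
  let ?q = "x * q + y ^ i"
  have "?q - of_nat (Suc i) * x ^ (Suc i - 1) = x * (q - of_nat i * x ^ (i - 1)) + (- ((x - y) * q))"
    unfolding q(2)[symmetric] by (cases i) (simp_all add: algebra_simps)
  also have "\<dots> \<in> M"
    using assms q qR by (intro max_add max_mult2 max_minus max_mult) auto
  finally have "?q - of_nat (Suc i) * x ^ (Suc i - 1) \<in> M" .
  moreover have "x ^ Suc i - y ^ Suc i = x * (x ^ i - y ^ i) + (x - y) * y ^ i"
    by (simp add: algebra_simps)
  then have "x ^ Suc i - y ^ Suc i = (x - y) * ?q"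
    unfolding q(2) by (simp add: algebra_simps)
  ultimately show ?case by blast
qed

text \<open>
  Summing the congruences for the powers, the difference quotient of \<open>\<phi>\<close> is congruent to the
  derivative of \<open>\<phi>\<close> at \<open>x\<close>, hence lies in \<open>M\<close>.
\<close>

lemma poly_diff_contracts:
  assumes "x \<in> R" "y \<in> R" "x - y \<in> M"
  shows "\<exists>m\<in>M. poly \<phi> x - poly \<phi> y = (x - y) * m"
proof -
  obtain q where q: "\<And>i. q i - of_nat i * x ^ (i - 1) \<in> M"
    "\<And>i. x ^ i - y ^ i = (x - y) * q i"
    using power_diff_factor[OF assms] by metis
  have "coeff \<phi> i * q i \<in> M" for i
  proof -
    have "coeff \<phi> i * q i =
        coeff \<phi> i * (q i - of_nat i * x ^ (i - 1)) + of_nat i * coeff \<phi> i * x ^ (i - 1)"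
      by (simp add: algebra_simps)
    also have "\<dots> \<in> M"
      by (intro max_add max_mult2 coeff_mem q max_mult deriv_coeff_mem power_mem assms)
    finally show ?thesis .
  qed
  then have "(\<Sum>i\<le>degree \<phi>. coeff \<phi> i * q i) \<in> M" by (intro max_sum)
  moreover have "poly \<phi> x - poly \<phi> y = (\<Sum>i\<le>degree \<phi>. coeff \<phi> i * (x ^ i - y ^ i))"
    by (simp add: poly_altdef sum_subtractf right_diff_distrib)
  then have "poly \<phi> x - poly \<phi> y = (x - y) * (\<Sum>i\<le>degree \<phi>. coeff \<phi> i * q i)"
    by (simp add: q(2) sum_distrib_left mult_ac)
  ultimately show ?thesis by blast
qed

lemma iterate_diff_contracts:
  assumes "x \<in> R" "y \<in> R" "x - y \<in> M" "n > 0"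
  shows "\<exists>m\<in>M. (poly \<phi> ^^ n) x - (poly \<phi> ^^ n) y = (x - y) * m"
  using \<open>n > 0\<close>
proof (induction n rule: nat_induct_non_zero)
  case 1
  then show ?case using poly_diff_contracts[OF assms(1-3)] by simp
next
  case (Suc n)
  let ?x = "(poly \<phi> ^^ n) x" and ?y = "(poly \<phi> ^^ n) y"
  from Suc obtain m where m: "m \<in> M" "?x - ?y = (x - y) * m" by blast
  then have "?x - ?y \<in> M" using assms max_mult max_subset by auto
  with poly_diff_contracts[of ?x ?y] iterate_mem assms obtain m'
    where m': "m' \<in> M" "poly \<phi> ?x - poly \<phi> ?y = (?x - ?y) * m'" by blast
  then have "(poly \<phi> ^^ Suc n) x - (poly \<phi> ^^ Suc n) y = (x - y) * (m * m')"
    by (simp add: m(2) mult.assoc)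
  moreover have "m * m' \<in> M" using m m' max_mult max_subset by auto
  ultimately show ?case by blast
qed

lemma periodic_congruent_imp_eq:
  assumes "x \<in> Per \<phi>" "y \<in> Per \<phi>" "x - y \<in> M"
  shows "x = y"
proof -
  from assms obtain j k where jk: "j > 0" "(poly \<phi> ^^ j) x = x" "k > 0" "(poly \<phi> ^^ k) y = y"
    by (auto simp: Per_def)
  have fixpoint: "((f :: 'k \<Rightarrow> 'k) ^^ (a * b)) z = z" if "(f ^^ a) z = z" for f a b z
    using that by (induction b) (simp_all add: funpow_add)
  have "(poly \<phi> ^^ (j * k)) x = x" "(poly \<phi> ^^ (j * k)) y = y"
    using fixpoint[of j "poly \<phi>" x k] fixpoint[of k "poly \<phi>" y j] jk by (simp_all add: mult.commute)
  moreover have "j * k > 0" using jk by simp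
  \<comment> \<open>A common multiple of the two periods fixes both points.\<close>
  ultimately obtain m where "m \<in> M" "x - y = (x - y) * m"
    using iterate_diff_contracts[OF periodic_integral[OF assms(1)] periodic_integral[OF assms(2)] assms(3)]
    by metis
  then show ?thesis using one_notin_max by auto
qed

end

section \<open>Integer relations and finite residue rings\<close>

lemma common_denominator:
  fixes r :: "nat \<Rightarrow> rat"
  assumes "finite A"
  shows "\<exists>N::int. N \<noteq> 0 \<and> (\<forall>i\<in>A. of_int N * r i \<in> \<int>)"
  using assms
proof (induction A)
  case empty
  then show ?case by (intro exI[of _ 1]) auto
next
  case (insert a A)
  then obtain N :: int where N: "N \<noteq> 0" "\<forall>i\<in>A. of_int N * r i \<in> \<int>" by blast
  obtain m n :: int where mn: "r a = of_int m / of_int n" "n > 0"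
    using quotient_of_denom_pos[of "r a"] quotient_of_div[of "r a"]
    by (metis surj_pair)
  have "of_int (N * n) * r i \<in> \<int>" if "i \<in> insert a A" for i
  proof (cases "i = a")
    case True
    then show ?thesis using mn by simp
  next
    case False
    then have "of_int N * r i \<in> \<int>" using that N by blast
    then have "of_int n * (of_int N * r i) \<in> \<int>" by (rule Ints_mult[OF Ints_of_int])
    moreover have "of_int n * (of_int N * r i) = of_int (N * n) * r i" by (simp only: of_int_mult mult_ac)
    ultimately show ?thesis by metis
  qed
  then show ?case using N mn by (intro exI[of _ "N * n"]) auto
qed

lemma rational_dependence:
  fixes x :: "nat \<Rightarrow> 'k::field_char_0"
  assumes "number_field_of_degree TYPE('k) D"
  shows "\<exists>r::nat \<Rightarrow> rat. (\<exists>i\<le>D. r i \<noteq> 0) \<and> (\<Sum>i\<le>D. of_rat (r i) * x i) = 0"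
proof (cases "inj_on x {..D}")
  case True
  from assms obtain B :: "'k set"
    where "finite_dimensional_vector_space (\<lambda>(q::rat) (x::'k). of_rat q * x) B" and B: "card B = D"
    unfolding number_field_of_degree_def by blast
  then interpret finite_dimensional_vector_space "\<lambda>(q::rat) (x::'k). of_rat q * x" B by simp
  have "card (x ` {..D}) > dim (x ` {..D})"
    using card_image[OF True] dim_subset_UNIV[of "x ` {..D}"] B by (simp add: dimension_def)
  then have "dependent (x ` {..D})"
    by (intro dependent_biggerset_general) auto
  then obtain u v where u: "v \<in> x ` {..D}" "u v \<noteq> 0" "(\<Sum>v\<in>x ` {..D}. of_rat (u v) * v) = 0"
    by (subst (asm) dependent_finite) auto
  then show ?thesis
    by (intro exI[of _ "\<lambda>i. u (x i)"]) (auto simp: sum.reindex[OF True])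
next
  case False
  then obtain i j where ij: "i \<le> D" "j \<le> D" "i \<noteq> j" "x i = x j" by (auto simp: inj_on_def)
  define r :: "nat \<Rightarrow> rat" where "r = (\<lambda>k. if k = i then 1 else if k = j then - 1 else 0)"
  have "(\<Sum>k\<le>D. of_rat (r k) * x k) = (\<Sum>k\<in>{i, j}. of_rat (r k) * x k)"
    using ij by (intro sum.mono_neutral_right) (auto simp: r_def)
  also have "\<dots> = 0" using ij by (simp add: r_def of_rat_minus)
  finally show ?thesis using ij by (intro exI[of _ r]) (auto simp: r_def)
qed

lemma integer_dependence:
  fixes x :: "nat \<Rightarrow> 'k::field_char_0"
  assumes "number_field_of_degree TYPE('k) D"
  shows "\<exists>c::nat \<Rightarrow> int. (\<exists>i\<le>D. c i \<noteq> 0) \<and> (\<Sum>i\<le>D. of_int (c i) * x i) = 0"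
proof -
  obtain r :: "nat \<Rightarrow> rat" where r: "\<exists>i\<le>D. r i \<noteq> 0" "(\<Sum>i\<le>D. of_rat (r i) * x i) = 0"
    using rational_dependence[OF assms] by blast
  obtain N :: int where N: "N \<noteq> 0" "\<forall>i\<in>{..D}. of_int N * r i \<in> \<int>"
    using common_denominator by blast
  define c where "c i = \<lfloor>of_int N * r i\<rfloor>" for i
  have c: "of_int N * r i = of_int (c i)" if "i \<le> D" for i
    using N(2) that by (auto simp: c_def elim!: Ints_cases)
  have "of_int (c i) = of_int N * (of_rat (r i) :: 'k)" if "i \<le> D" for i
    using arg_cong[OF c[OF that], of "of_rat :: rat \<Rightarrow> 'k"] by (simp add: of_rat_mult)
  then have "(\<Sum>i\<le>D. of_int (c i) * x i) = of_int N * (\<Sum>i\<le>D. of_rat (r i) * x i)"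
    by (simp add: sum_distrib_left mult.assoc)
  moreover have "c i \<noteq> 0" if "i \<le> D" "r i \<noteq> 0" for i using c[OF that(1)] that(2) N(1) by auto
  then have "\<exists>i\<le>D. c i \<noteq> 0" using r(1) by blast
  ultimately show ?thesis using r(2) by auto
qed

text \<open>
  Dividing an integer relation by the greatest common divisor of its coefficients keeps it
  nontrivial modulo \<open>p\<close>. This is what bounds dimensions after reduction.
\<close>

lemma primitive_integer_dependence:
  fixes x :: "nat \<Rightarrow> 'k::field_char_0" and p :: int
  assumes "number_field_of_degree TYPE('k) D" "\<not> is_unit p"
  shows "\<exists>c::nat \<Rightarrow> int. (\<exists>i\<le>D. \<not> p dvd c i) \<and> (\<Sum>i\<le>D. of_int (c i) * x i) = 0"
proof -
  obtain c :: "nat \<Rightarrow> int" where c: "\<exists>i\<le>D. c i \<noteq> 0" "(\<Sum>i\<le>D. of_int (c i) * x i) = 0"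
    using integer_dependence[OF assms(1)] by blast
  define g where "g = Gcd (c ` {..D})"
  have g0: "g \<noteq> 0" using c(1) by (auto simp: g_def)
  define c' where "c' i = c i div g" for i
  have cc': "c i = g * c' i" if "i \<le> D" for i
    using that by (simp add: c'_def g_def)
  have "of_int g * (\<Sum>i\<le>D. of_int (c' i) * x i) = (\<Sum>i\<le>D. of_int (c i) * x i)"
    by (simp add: sum_distrib_left cc' mult.assoc)
  then have "(\<Sum>i\<le>D. of_int (c' i) * x i) = 0" using c(2) g0 by simp
  moreover have "\<exists>i\<le>D. \<not> p dvd c' i"
  proof (rule ccontr)
    assume "\<not> (\<exists>i\<le>D. \<not> p dvd c' i)"
    then have "g * p dvd c i" if "i \<le> D" for i
      unfolding cc'[OF that] using that by (intro mult_dvd_mono) auto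
    then have "g * p dvd Gcd (c ` {..D})" by (intro Gcd_greatest) auto
    then have "g * p dvd g" by (simp add: g_def)
    then show False using g0 assms(2) by (simp add: dvd_mult_cancel_left)
  qed
  ultimately show ?thesis by blast
qed

lemma algebraic_if_number_field:
  fixes z :: "'k::field_char_0"
  assumes "number_field_of_degree TYPE('k) D"
  shows "algebraic z"
proof -
  obtain c :: "nat \<Rightarrow> int" where c: "\<exists>i\<le>D. c i \<noteq> 0" "(\<Sum>i\<le>D. of_int (c i) * z ^ i) = 0"
    using integer_dependence[OF assms] by blast
  define f :: "'k poly" where "f = (\<Sum>i\<le>D. monom (of_int (c i)) i)"
  have cf: "coeff f j = (if j \<le> D then of_int (c j) else 0)" for j
    by (simp add: f_def coeff_sum coeff_monom)
  show ?thesis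
  proof (rule algebraicI)
    show "coeff f j \<in> \<int>" for j by (simp add: cf)
    show "f \<noteq> 0" using c(1) cf by (metis coeff_0 of_int_eq_0_iff)
    show "poly f z = 0" using c(2) by (simp add: f_def poly_sum poly_monom)
  qed
qed

text \<open>
  If \<open>l\<close> is the leading coefficient of an integer polynomial \<open>f\<close> of degree \<open>d\<close> with root \<open>z\<close>,
  then \<open>l z\<close> is a root of the monic integer polynomial \<open>l\<^sup>d\<^sup>-\<^sup>1 f(X/l)\<close>.
\<close>

lemma algebraic_int_multiple:
  fixes z :: "'k::field_char_0"
  assumes "algebraic z"
  shows "\<exists>l::int. l \<noteq> 0 \<and> algebraic_int (of_int l * z)"
proof -
  obtain f :: "int poly" where f: "f \<noteq> 0" "poly (map_poly of_int f) z = 0"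
    using assms by (rule algebraicE')
  let ?d = "degree f"
  define l where "l = lead_coeff f"
  have l0: "l \<noteq> 0" using f by (simp add: l_def)
  show ?thesis
  proof (cases "?d = 0")
    case True
    then obtain c where "f = [:c:]" by (rule degree_eq_zeroE)
    then show ?thesis using f by (simp add: map_poly_pCons)
  next
    case False
    define g :: "'k poly" where
      "g = monom 1 ?d + (\<Sum>i<?d. monom (of_int (coeff f i * l ^ (?d - 1 - i))) i)"
    have cg: "coeff g j = (if j = ?d then 1 else if j < ?d then of_int (coeff f j * l ^ (?d - 1 - j)) else 0)" for j
      by (simp add: g_def coeff_sum coeff_monom)
    have "degree g = ?d"
      by (intro antisym degree_le le_degree) (auto simp: cg)
    have "of_int (coeff f i) * (of_int l ^ (?d - 1 - i) * (of_int l ^ i * z ^ i)) =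
        of_int l ^ (?d - 1) * (of_int (coeff f i) * z ^ i)" if "i < ?d" for i
    proof -
      have "(of_int l :: 'k) ^ (?d - 1) = of_int l ^ (?d - 1 - i) * of_int l ^ i"
        using that by (simp flip: power_add)
      then show ?thesis by (simp only: mult_ac)
    qed
    then have "(\<Sum>i<?d. of_int (coeff f i) * (of_int l ^ (?d - 1 - i) * (of_int l ^ i * z ^ i))) =
        (\<Sum>i<?d. of_int l ^ (?d - 1) * (of_int (coeff f i) * z ^ i))"
      by (intro sum.cong refl) (simp only: lessThan_iff)
    note terms = this
    have ld: "(of_int l :: 'k) ^ ?d = of_int l ^ (?d - 1) * of_int l"
      using False by (subst power_minus_mult) auto
    have "poly g (of_int l * z) = of_int l ^ ?d * z ^ ?d +
        (\<Sum>i<?d. of_int (coeff f i) * (of_int l ^ (?d - 1 - i) * (of_int l ^ i * z ^ i)))"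
      by (simp add: g_def poly_sum poly_monom power_mult_distrib mult.assoc)
    also have "\<dots> = of_int l ^ (?d - 1) * (of_int l * z ^ ?d + (\<Sum>i<?d. of_int (coeff f i) * z ^ i))"
      unfolding terms ld by (simp only: distrib_left sum_distrib_left mult.assoc)
    also have "of_int l * z ^ ?d + (\<Sum>i<?d. of_int (coeff f i) * z ^ i) = poly (map_poly of_int f) z"
      by (simp add: poly_altdef l_def lessThan_Suc_atMost[symmetric] coeff_map_poly degree_map_poly)
    finally have "poly g (of_int l * z) = 0" using f by simp
    then have "algebraic_int (of_int l * z)"
      using \<open>degree g = ?d\<close> by (intro algebraic_int.intros[of g]) (auto simp: cg)
    then show ?thesis using l0 by blast
  qed
qed

lemma pigeonhole_nat:
  fixes f :: "nat \<Rightarrow> 'a"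
  assumes "finite A" "\<And>i. f i \<in> A"
  obtains i j where "i < j" "f i = f j"
proof -
  have "\<not> inj f" using assms by (metis finite_imageD finite_subset image_subsetI infinite_UNIV_nat)
  then obtain i j where "i \<noteq> j" "f i = f j" by (auto simp: inj_on_def)
  then show ?thesis using that by (metis linorder_neqE_nat)
qed

text \<open>
  That \<open>P\<close> is a prime ideal includes that the algebraic integers of \<open>K\<close> form a commutative ring;
  their closure under addition and multiplication is read off from there.
\<close>

locale number_field_prime =
  fixes P :: "'k::field_char_0 set" and D :: nat
  assumes number_field: "number_field_of_degree TYPE('k) D"
    and primeideal: "primeideal P (ring_of_integers :: 'k ring)"
    and nonzero: "P \<noteq> {0}"
begin

abbreviation \<O> :: "'k ring" where "\<O> \<equiv> ring_of_integers"

sublocale primeideal P \<O> by (rule primeideal)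

lemma ring_of_integers_simps:
  "carrier \<O> = {x. algebraic_int x}" "x \<otimes>\<^bsub>\<O>\<^esub> y = x * y" "x \<oplus>\<^bsub>\<O>\<^esub> y = x + y"
  "\<one>\<^bsub>\<O>\<^esub> = 1" "\<zero>\<^bsub>\<O>\<^esub> = 0"
  by (simp_all add: ring_of_integers_def)

lemma algebraic_int_add: "algebraic_int x \<Longrightarrow> algebraic_int y \<Longrightarrow> algebraic_int (x + y)" for x y :: 'k
  using add.m_closed[of x y] by (simp add: ring_of_integers_simps)

lemma algebraic_int_mult: "algebraic_int x \<Longrightarrow> algebraic_int y \<Longrightarrow> algebraic_int (x * y)" for x y :: 'k
  using m_closed[of x y] by (simp add: ring_of_integers_simps)

lemma algebraic_int_diff: "algebraic_int x \<Longrightarrow> algebraic_int y \<Longrightarrow> algebraic_int (x - y)" for x y :: 'k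
  using algebraic_int_add[of x "- y"] by simp

lemma algebraic_int_power: "algebraic_int x \<Longrightarrow> algebraic_int (x ^ n)" for x :: 'k
  by (induction n) (auto intro: algebraic_int_mult)

lemma algebraic_int_sum: "(\<And>i. i \<in> A \<Longrightarrow> algebraic_int (f i)) \<Longrightarrow> algebraic_int (sum f A)" for f :: "_ \<Rightarrow> 'k"
  by (induction A rule: infinite_finite_induct) (auto intro: algebraic_int_add)

lemma prime_algebraic_int: "x \<in> P \<Longrightarrow> algebraic_int x"
  using a_subset by (auto simp: ring_of_integers_simps)

lemma prime_zero: "0 \<in> P"
  using additive_subgroup.zero_closed[OF is_additive_subgroup] by (simp add: ring_of_integers_simps)

lemma prime_add: "x \<in> P \<Longrightarrow> y \<in> P \<Longrightarrow> x + y \<in> P"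
  using additive_subgroup.a_closed[OF is_additive_subgroup, of x y] by (simp add: ring_of_integers_simps)

lemma prime_mult: "x \<in> P \<Longrightarrow> algebraic_int y \<Longrightarrow> x * y \<in> P"
  using I_r_closed[of x y] by (simp add: ring_of_integers_simps)

lemma prime_mult2: "x \<in> P \<Longrightarrow> algebraic_int y \<Longrightarrow> y * x \<in> P"
  using prime_mult by (simp add: mult.commute)

lemma prime_minus: "x \<in> P \<Longrightarrow> - x \<in> P"
  using prime_mult[of x "- 1"] by simp

lemma prime_diff: "x \<in> P \<Longrightarrow> y \<in> P \<Longrightarrow> x - y \<in> P"
  using prime_add[of x "- y"] prime_minus by simp

lemma one_notin_prime: "1 \<notin> P"
  using I_notcarr one_imp_carrier by (auto simp: ring_of_integers_simps)

lemma mult_in_prime_iff: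
  assumes "algebraic_int x" "algebraic_int y"
  shows "x * y \<in> P \<longleftrightarrow> x \<in> P \<or> y \<in> P"
  using I_prime[of x y] assms prime_mult prime_mult2 by (auto simp: ring_of_integers_simps)

lemma notin_prime_mult:
  "algebraic_int x \<Longrightarrow> x \<notin> P \<Longrightarrow> algebraic_int y \<Longrightarrow> y \<notin> P \<Longrightarrow> x * y \<notin> P"
  by (simp add: mult_in_prime_iff)

lemma notin_prime_power: "algebraic_int x \<Longrightarrow> x \<notin> P \<Longrightarrow> x ^ n \<notin> P"
  by (induction n) (simp_all add: one_notin_prime notin_prime_mult algebraic_int_power)

lemma prime_power: "x \<in> P \<Longrightarrow> n > 0 \<Longrightarrow> x ^ n \<in> P"
  by (cases n) (auto intro: prime_mult algebraic_int_power prime_algebraic_int)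

text \<open>
  The constant coefficient of an integer polynomial \<open>c + X g(X)\<close> with root \<open>x\<close> is a multiple of
  \<open>x\<close>. This reduces divisibility questions about algebraic integers to rational integers.
\<close>

lemma algebraic_int_dvd_integer:
  assumes "algebraic_int (x :: 'k)" "x \<noteq> 0"
  shows "\<exists>N y. N \<noteq> 0 \<and> algebraic_int y \<and> of_int N = x * y"
proof -
  obtain f :: "int poly" where f: "coeff f 0 \<noteq> 0" "poly (map_poly of_int f) x = 0"
    using algebraicE'_nonzero[of x] assms by auto
  obtain c g where cg: "f = pCons c g" by (cases f)
  have "algebraic_int (poly (map_poly of_int g) x)"
    unfolding poly_altdef
    by (intro algebraic_int_sum algebraic_int_mult algebraic_int_power assms) (simp add: coeff_map_poly)
  moreover have "of_int c = x * (- poly (map_poly of_int g) x)"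
    using f by (simp add: cg map_poly_pCons eq_neg_iff_add_eq_0)
  ultimately show ?thesis using f cg
    by (intro exI[of _ c] exI[of _ "- poly (map_poly of_int g) x"]) auto
qed

lemma fraction_of_algebraic_ints: "\<exists>a b. algebraic_int a \<and> algebraic_int b \<and> b \<noteq> 0 \<and> z = a / b" for z :: 'k
proof -
  obtain l :: int where l: "l \<noteq> 0" "algebraic_int (of_int l * z)"
    using algebraic_int_multiple algebraic_if_number_field[OF number_field] by blast
  then show ?thesis
    by (intro exI[of _ "of_int l * z"] exI[of _ "of_int l"]) auto
qed

lemma coprime_notin_prime:
  assumes "coprime m (n :: int)" "of_int m \<in> P"
  shows "of_int n \<notin> P"
proof
  assume n: "of_int n \<in> P"
  obtain a b where "a * m + b * n = 1" using assms(1) by (metis bezout_int coprime_imp_gcd_eq_1)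
  then have "of_int a * of_int m + of_int b * of_int n = (1 :: 'k)"
    by (metis of_int_1 of_int_add of_int_mult)
  moreover have "of_int a * of_int m + of_int b * of_int n \<in> P"
    by (intro prime_add prime_mult2 assms n) auto
  ultimately show False using one_notin_prime by simp
qed

lemma ex_rational_prime: "\<exists>p. Factorial_Ring.prime p \<and> of_nat p \<in> P"
proof -
  obtain x where x: "x \<in> P" "x \<noteq> 0" using nonzero prime_zero by blast
  obtain N y where N: "N \<noteq> 0" "algebraic_int y" "of_int N = x * y"
    using algebraic_int_dvd_integer x prime_algebraic_int by blast
  have "of_nat (nat \<bar>N\<bar>) \<in> P"
    using prime_mult[OF x(1) N(2)] prime_minus[of "x * y"] by (auto simp: N(3)[symmetric] abs_if)
  moreover have "nat \<bar>N\<bar> > 0" using N by simp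
  moreover have "n > 0 \<Longrightarrow> of_nat n \<in> P \<Longrightarrow> ?thesis" for n
  proof (induction n rule: less_induct)
    case (less n)
    have "n \<noteq> 1" using less one_notin_prime by auto
    then obtain q where q: "Factorial_Ring.prime q" "q dvd n" using prime_factor_nat by blast
    then obtain m where m: "n = q * m" by auto
    show ?case
    proof (cases "of_nat q \<in> P")
      case False
      then have "of_nat m \<in> P" using less.prems notin_prime_mult[of "of_nat q" "of_nat m"] m by auto
      moreover have "m < n" using m less.prems q(1) prime_gt_1_nat by auto
      ultimately show ?thesis using less.IH[of m] less.prems m by auto
    qed (use q in auto)
  qed
  ultimately show ?thesis by blast
qed

abbreviation p :: nat where "p \<equiv> prime_below P"

lemma prime_below: "Factorial_Ring.prime p" "of_nat p \<in> P"
proof -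
  have "q = r" if "Factorial_Ring.prime q" "Factorial_Ring.prime r" "of_nat q \<in> P" "of_nat r \<in> P" for q r
    using coprime_notin_prime[of "int q" "int r"] that primes_coprime[of q r] by auto
  then have "\<exists>!p. Factorial_Ring.prime p \<and> of_nat p \<in> P" using ex_rational_prime by blast
  then have "Factorial_Ring.prime p \<and> of_nat p \<in> P" unfolding prime_below_def by (rule theI')
  then show "Factorial_Ring.prime p" "of_nat p \<in> P" by auto
qed

lemma p_nonzero: "(of_nat p :: 'k) \<noteq> 0"
  using prime_below(1) by (simp add: prime_gt_0_nat)

lemma of_int_in_prime_iff: "of_int n \<in> P \<longleftrightarrow> int p dvd n"
proof
  assume "of_int n \<in> P"
  then have "\<not> coprime (int p) n" using coprime_notin_prime[of "int p" n] prime_below by auto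
  then show "int p dvd n" using prime_below(1) by (meson prime_imp_coprime prime_nat_int_transfer)
next
  assume "int p dvd n"
  then obtain k where "n = int p * k" by auto
  then show "of_int n \<in> P" using prime_mult[OF prime_below(2), of "of_int k"] by simp
qed

text \<open>
  An ideal \<open>I\<close> containing \<open>pO\<close> makes \<open>O/I\<close> a vector space over the field with \<open>p\<close> elements,
  and a primitive integer relation between \<open>D + 1\<close> elements stays nontrivial there. So a maximal
  independent family has at most \<open>D\<close> members and its combinations with coefficients in
  \<open>{0..<p}\<close> represent all classes. It is needed both for \<open>I = P\<close> and for \<open>I = pO\<close>.
\<close>

lemma residues_bound:
  assumes zero: "0 \<in> I" and add: "\<And>a b. a \<in> I \<Longrightarrow> b \<in> I \<Longrightarrow> a + b \<in> I"
    and mult: "\<And>a b. a \<in> I \<Longrightarrow> algebraic_int b \<Longrightarrow> a * b \<in> I"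
    and p: "\<And>a :: 'k. algebraic_int a \<Longrightarrow> of_nat p * a \<in> I"
  shows "\<exists>F. finite F \<and> card F \<le> p ^ D \<and> F \<subseteq> {a. algebraic_int a} \<and>
    (\<forall>y. algebraic_int y \<longrightarrow> (\<exists>r\<in>F. y - r \<in> I))"
proof -
  have sum: "sum f A \<in> I" if "\<And>i. i \<in> A \<Longrightarrow> f i \<in> I" for f and A :: "nat set"
    using that by (induction A rule: infinite_finite_induct) (auto intro: zero add)
  define indep where "indep n x \<longleftrightarrow> (\<forall>i<n. algebraic_int (x i)) \<and>
     (\<forall>c. (\<Sum>i<n. of_int (c i) * x i) \<in> I \<longrightarrow> (\<forall>i<n. int p dvd c i))" for n and x :: "nat \<Rightarrow> 'k"
  have bound: "n \<le> D" if ind: "indep n x" for n x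
  proof (rule ccontr)
    assume nD: "\<not> n \<le> D"
    have "\<not> is_unit (int p)" using prime_below(1) by (metis not_prime_unit prime_nat_int_transfer)
    then obtain c where c: "\<exists>i\<le>D. \<not> int p dvd c i" "(\<Sum>i\<le>D. of_int (c i) * x i) = 0"
      using primitive_integer_dependence[OF number_field, of "int p" x] by blast
    define c' where "c' i = (if i \<le> D then c i else 0)" for i
    have "(\<Sum>i<n. of_int (c' i) * x i) = (\<Sum>i\<le>D. of_int (c' i) * x i)"
      using nD by (intro sum.mono_neutral_right) (auto simp: c'_def)
    also have "\<dots> = 0" using c(2) by (simp add: c'_def)
    finally have "\<forall>i<n. int p dvd c' i" using ind zero unfolding indep_def by metis
    then have "int p dvd c i" if "i \<le> D" for i
      using that nD by (metis c'_def le_less_trans not_le)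
    then show False using c(1) by blast
  qed
  have "indep 0 (\<lambda>_. 0)" by (simp add: indep_def)
  then have "\<exists>n. (\<exists>x. indep n x) \<and> (\<forall>m. (\<exists>x. indep m x) \<longrightarrow> m \<le> n)"
    using Greatest_le_nat[of "\<lambda>n. \<exists>x. indep n x" _ D] GreatestI_ex_nat[of "\<lambda>n. \<exists>x. indep n x" D] bound
    by blast
  then obtain n x where nx: "indep n x" and max: "\<And>m x. indep m x \<Longrightarrow> m \<le> n" by blast
  have ai: "algebraic_int (x i)" if "i < n" for i using nx that by (auto simp: indep_def)
  define F where "F = (\<lambda>c. \<Sum>i<n. of_nat (c i) * x i) ` ({..<n} \<rightarrow>\<^sub>E {..<p})"
  have "finite F" unfolding F_def by (intro finite_imageI finite_PiE) auto
  moreover have "card F \<le> p ^ D"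
  proof -
    have "card F \<le> card ({..<n} \<rightarrow>\<^sub>E {..<p})" unfolding F_def by (intro card_image_le finite_PiE) auto
    also have "\<dots> = p ^ n" by (simp add: card_PiE)
    also have "\<dots> \<le> p ^ D" using bound[OF nx] prime_below(1) by (intro power_increasing) (auto simp: Suc_le_eq prime_gt_0_nat)
    finally show ?thesis .
  qed
  moreover have "F \<subseteq> {a. algebraic_int a}"
    unfolding F_def by (auto intro!: algebraic_int_sum algebraic_int_mult ai)
  moreover have "\<exists>r\<in>F. y - r \<in> I" if y: "algebraic_int y" for y
  proof -
    \<comment> \<open>By maximality \<open>y\<close> depends on the family, and its own coefficient is invertible modulo \<open>p\<close>.\<close>
    have "\<not> indep (Suc n) (x(n := y))" using max by fastforce
    then obtain c where c: "(\<Sum>i<Suc n. of_int (c i) * (x(n := y)) i) \<in> I" "\<exists>i<Suc n. \<not> int p dvd c i"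
      using ai y by (auto simp: indep_def less_Suc_eq)
    have c1: "(\<Sum>i<n. of_int (c i) * x i) + of_int (c n) * y \<in> I" using c(1) by simp
    have "\<not> int p dvd c n"
    proof
      assume "int p dvd c n"
      then obtain k where k: "c n = int p * k" by auto
      have "of_nat p * (- of_int k * y) \<in> I" using y by (intro p algebraic_int_mult) auto
      with c1 have "(\<Sum>i<n. of_int (c i) * x i) + of_int (c n) * y + of_nat p * (- of_int k * y) \<in> I"
        by (rule add)
      then have "(\<Sum>i<n. of_int (c i) * x i) \<in> I" by (simp add: k mult.assoc)
      then have "\<forall>i<n. int p dvd c i" using nx by (auto simp: indep_def)
      then show False using c(2) \<open>int p dvd c n\<close> by (auto simp: less_Suc_eq)
    qed
    then have "coprime (c n) (int p)"
      using prime_below(1) by (meson coprime_commute prime_imp_coprime prime_nat_int_transfer)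
    then obtain a b where ab: "a * c n + b * int p = 1" by (metis bezout_int coprime_imp_gcd_eq_1)
    \<comment> \<open>Multiplying the relation by an inverse \<open>a\<close> of \<open>c n\<close> solves it for \<open>y\<close>; \<open>e i\<close> is the reduced coefficient.\<close>
    define e where "e i = nat ((- a * c i) mod int p)" for i
    have p0: "int p > 0" using prime_below(1) by (simp add: prime_gt_0_nat)
    define q where "q i = (- a * c i) div int p" for i
    have e: "int (e i) = - a * c i - int p * q i" for i
      using p0 by (simp add: e_def q_def minus_mult_div_eq_mod)
    define r where "r = (\<Sum>i<n. of_nat (restrict e {..<n} i) * x i)"
    have "restrict e {..<n} \<in> {..<n} \<rightarrow>\<^sub>E {..<p}"
      using p0 by (auto simp: e_def nat_less_iff)
    then have "r \<in> F" unfolding F_def r_def by blast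
    have e': "of_nat (e i) = - of_int a * of_int (c i) - of_nat p * (of_int (q i) :: 'k)" for i
      using arg_cong[OF e[of i], of "of_int :: int \<Rightarrow> 'k"] by simp
    have "r = (\<Sum>i<n. - (of_int a * (of_int (c i) * x i)) - of_nat p * (of_int (q i) * x i))"
      unfolding r_def by (intro sum.cong) (auto simp: e' algebra_simps)
    also have "\<dots> = - (of_int a * (\<Sum>i<n. of_int (c i) * x i)) - of_nat p * (\<Sum>i<n. of_int (q i) * x i)"
      by (simp add: sum_subtractf sum_negf sum_distrib_left)
    finally have r: "r = \<dots>" .
    have "of_int a * of_int (c n) + of_int b * of_nat p = (1 :: 'k)"
      using arg_cong[OF ab, of "of_int :: int \<Rightarrow> 'k"] by simp
    then have "y = (of_int a * of_int (c n) + of_int b * of_nat p) * y" by simp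
    then have "y - r = ((\<Sum>i<n. of_int (c i) * x i) + of_int (c n) * y) * of_int a
        + of_nat p * (of_int b * y + (\<Sum>i<n. of_int (q i) * x i))"
      unfolding r by (simp add: algebra_simps)
    also have "\<dots> \<in> I"
      using y ai by (intro add mult[OF c1] p algebraic_int_add algebraic_int_mult algebraic_int_sum) auto
    finally show ?thesis using \<open>r \<in> F\<close> by blast
  qed
  ultimately show ?thesis by blast
qed

section \<open>The local ring at a prime and its uniformizer\<close>

lemma finite_residues_p:
  "\<exists>F. finite F \<and> F \<subseteq> {a. algebraic_int a} \<and>
    (\<forall>y::'k. algebraic_int y \<longrightarrow> (\<exists>r\<in>F. algebraic_int ((y - r) / of_nat p)))"
proof -
  have "\<exists>F. finite F \<and> card F \<le> p ^ D \<and> F \<subseteq> {a. algebraic_int a} \<and>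
    (\<forall>y. algebraic_int y \<longrightarrow> (\<exists>r\<in>F. y - r \<in> {a. algebraic_int (a / of_nat p :: 'k)}))"
  proof (rule residues_bound)
    show "a + b \<in> {a. algebraic_int (a / of_nat p :: 'k)}"
      if "a \<in> {a. algebraic_int (a / of_nat p :: 'k)}" "b \<in> {a. algebraic_int (a / of_nat p :: 'k)}" for a b
      using that algebraic_int_add[of "a / of_nat p" "b / of_nat p"] by (simp add: add_divide_distrib)
    show "a * b \<in> {a. algebraic_int (a / of_nat p :: 'k)}"
      if "a \<in> {a. algebraic_int (a / of_nat p :: 'k)}" "algebraic_int b" for a b
      using that algebraic_int_mult[of "a / of_nat p" b] by simp
  qed (use p_nonzero in auto)
  then show ?thesis by auto
qed

lemma pigeonhole_mod_p:
  fixes f :: "nat \<Rightarrow> 'k"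
  assumes "\<And>i. algebraic_int (f i)"
  obtains i j where "i < j" "algebraic_int ((f j - f i) / of_nat p)"
proof -
  obtain F where F: "finite F" "\<And>y::'k. algebraic_int y \<Longrightarrow> \<exists>r\<in>F. algebraic_int ((y - r) / of_nat p)"
    using finite_residues_p by blast
  obtain r where r: "\<And>i. r i \<in> F" "\<And>i. algebraic_int ((f i - r i) / of_nat p)"
    using F(2)[OF assms] by metis
  obtain i j where ij: "i < j" "r i = r j" using pigeonhole_nat[OF F(1), of r] r(1) by blast
  have "(f j - f i) / of_nat p = (f j - r j) / of_nat p - (f i - r i) / of_nat p"
    by (simp add: ij diff_divide_distrib)
  then show ?thesis using that[OF ij(1)] algebraic_int_diff r(2) by metis
qed

lemma algebraic_int_div_p_in_prime: "algebraic_int (a / of_nat p) \<Longrightarrow> a \<in> P"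
  using prime_mult[OF prime_below(2), of "a / of_nat p"] p_nonzero by simp

text \<open>
  Two powers of \<open>s\<close> agree modulo \<open>pO\<close>; cancelling the common power, which is prime to \<open>P\<close>, leaves
  a power of \<open>s\<close> congruent to \<open>1\<close>. So \<open>P\<close> is maximal.
\<close>

lemma inverse_mod_prime:
  assumes s: "algebraic_int s" "s \<notin> P"
  shows "\<exists>t. algebraic_int t \<and> 1 - s * t \<in> P"
proof -
  obtain i j where ij: "i < j" "algebraic_int ((s ^ j - s ^ i) / of_nat p)"
    using pigeonhole_mod_p[of "\<lambda>i. s ^ i"] s algebraic_int_power by blast
  obtain k where k: "j = i + Suc k" using ij(1) less_imp_Suc_add by auto
  have "s ^ i * (1 - s * s ^ k) = - (s ^ j - s ^ i)" by (simp add: k algebra_simps power_add)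
  then have "s ^ i * (1 - s * s ^ k) \<in> P"
    using prime_minus[OF algebraic_int_div_p_in_prime[OF ij(2)]] by simp
  then have "1 - s * s ^ k \<in> P"
    using notin_prime_mult[of "s ^ i" "1 - s * s ^ k"] s
    by (meson algebraic_int_1 algebraic_int_diff algebraic_int_mult algebraic_int_power notin_prime_power)
  then show ?thesis using algebraic_int_power[OF s(1)] by blast
qed

text \<open>
  Again two powers \<open>y\<^sup>i\<close> and \<open>y\<^sup>j\<close> agree modulo \<open>pO\<close>, but now the factor \<open>y\<^sup>j\<^sup>-\<^sup>i - 1\<close> is the one
  prime to \<open>P\<close>: elements of \<open>P\<close> are locally nilpotent modulo \<open>p\<close>.
\<close>

lemma prime_power_divisible_by_p:
  assumes "y \<in> P"
  shows "\<exists>n s. algebraic_int s \<and> s \<notin> P \<and> algebraic_int (s * y ^ n / of_nat p)"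
proof -
  have y: "algebraic_int y" using assms by (rule prime_algebraic_int)
  obtain i j where ij: "i < j" "algebraic_int ((y ^ j - y ^ i) / of_nat p)"
    using pigeonhole_mod_p[of "\<lambda>i. y ^ i"] y algebraic_int_power by blast
  let ?s = "y ^ (j - i) - 1"
  have "?s \<notin> P"
  proof
    assume "?s \<in> P"
    moreover have "y ^ (j - i) \<in> P" using ij assms by (intro prime_power) auto
    ultimately have "y ^ (j - i) - ?s \<in> P" by (rule prime_diff[rotated])
    then show False using one_notin_prime by simp
  qed
  moreover have "?s * y ^ i = y ^ j - y ^ i" using ij by (simp add: left_diff_distrib flip: power_add)
  ultimately show ?thesis using ij(2) y
    by (intro exI[of _ i] exI[of _ ?s]) (auto intro: algebraic_int_diff algebraic_int_power)
qed

text \<open>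
  The first condition says that \<open>x\<close> is not locally divisible by \<open>p\<close>, the second that every \<open>x y\<close>
  is. Treat the elements of \<open>Y\<close> one after another: since \<open>y\<close> is locally nilpotent modulo \<open>p\<close>,
  multiply \<open>x\<close> by the largest power of \<open>y\<close> that keeps the first condition; the second condition
  survives multiplication of \<open>x\<close>.
\<close>

lemma ex_local_annihilator_finite:
  assumes "finite Y" "Y \<subseteq> P"
  shows "\<exists>x. algebraic_int x \<and>
    (\<forall>s. algebraic_int s \<longrightarrow> s \<notin> P \<longrightarrow> \<not> algebraic_int (s * x / of_nat p)) \<and>
    (\<forall>y\<in>Y. \<exists>s. algebraic_int s \<and> s \<notin> P \<and> algebraic_int (s * (x * y) / of_nat p))"
  using assms
proof (induction Y)
  case empty
  have "\<not> algebraic_int (s * 1 / of_nat p)" if "s \<notin> P" for s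
    using that algebraic_int_div_p_in_prime[of s] by auto
  then show ?case by (intro exI[of _ 1]) auto
next
  case (insert y Y)
  then obtain x where x: "algebraic_int x"
    "\<And>s. algebraic_int s \<Longrightarrow> s \<notin> P \<Longrightarrow> \<not> algebraic_int (s * x / of_nat p)"
    "\<And>z. z \<in> Y \<Longrightarrow> \<exists>s. algebraic_int s \<and> s \<notin> P \<and> algebraic_int (s * (x * z) / of_nat p)" by auto
  have y: "y \<in> P" "algebraic_int y" using insert prime_algebraic_int by auto
  define Z where "Z n \<longleftrightarrow> (\<exists>s. algebraic_int s \<and> s \<notin> P \<and> algebraic_int (s * (x * y ^ n) / of_nat p))" for n
  obtain n s where "algebraic_int s" "s \<notin> P" "algebraic_int (s * y ^ n / of_nat p)"
    using prime_power_divisible_by_p[OF y(1)] by blast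
  moreover have "s * (x * y ^ n) / of_nat p = x * (s * y ^ n / of_nat p)" by simp
  ultimately have "Z n" unfolding Z_def using algebraic_int_mult[OF x(1)] by metis
  moreover have "\<not> Z 0" using x(2) by (auto simp: Z_def)
  ultimately obtain k where k: "\<not> Z k" "Z (Suc k)" using ex_least_nat_less[of Z n] by blast
  let ?x = "x * y ^ k"
  have "\<exists>s. algebraic_int s \<and> s \<notin> P \<and> algebraic_int (s * (?x * z) / of_nat p)" if z: "z \<in> insert y Y" for z
  proof (cases "z = y")
    case True
    have "x * y ^ Suc k = ?x * z" using True by (simp add: mult_ac)
    then show ?thesis using k(2) unfolding Z_def by metis
  next
    case False
    then obtain s where s: "algebraic_int s" "s \<notin> P" "algebraic_int (s * (x * z) / of_nat p)"
      using x(3) z by auto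
    have "s * (?x * z) / of_nat p = s * (x * z) / of_nat p * y ^ k" by simp
    then show ?thesis using s algebraic_int_mult[OF s(3) algebraic_int_power[OF y(2), of k]] by metis
  qed
  moreover have "algebraic_int ?x" using x y by (intro algebraic_int_mult algebraic_int_power)
  ultimately show ?case using k(1) unfolding Z_def by blast
qed

text \<open>
  Apply the preceding lemma to representatives of the finitely many classes of \<open>P\<close> modulo \<open>pO\<close>,
  and clear the finitely many local denominators by their product \<open>s\<close>.
\<close>

lemma ex_annihilator_mod_p:
  "\<exists>b. algebraic_int b \<and> \<not> algebraic_int (b / of_nat p) \<and> (\<forall>y\<in>P. algebraic_int (b * y / of_nat p))"
proof -
  obtain F where F: "finite F" "\<And>y::'k. algebraic_int y \<Longrightarrow> \<exists>r\<in>F. algebraic_int ((y - r) / of_nat p)"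
    using finite_residues_p by blast
  obtain x where x: "algebraic_int x"
    "\<And>s. algebraic_int s \<Longrightarrow> s \<notin> P \<Longrightarrow> \<not> algebraic_int (s * x / of_nat p)"
    "\<And>y. y \<in> F \<inter> P \<Longrightarrow> \<exists>s. algebraic_int s \<and> s \<notin> P \<and> algebraic_int (s * (x * y) / of_nat p)"
    using ex_local_annihilator_finite[of "F \<inter> P"] F(1) by auto
  obtain t where t: "\<And>y. y \<in> F \<inter> P \<Longrightarrow> algebraic_int (t y) \<and> t y \<notin> P \<and> algebraic_int (t y * (x * y) / of_nat p)"
    using x(3) by metis
  have t_prod: "algebraic_int (prod t A) \<and> prod t A \<notin> P" if "A \<subseteq> F \<inter> P" for A
    using that
  proof (induction A rule: infinite_finite_induct)
    case (insert y A)
    then show ?case using t[of y] by (simp add: algebraic_int_mult notin_prime_mult)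
  qed (simp_all add: one_notin_prime)
  define s where "s = prod t (F \<inter> P)"
  have s: "algebraic_int s" "s \<notin> P" using t_prod[of "F \<inter> P"] by (auto simp: s_def)
  have F': "algebraic_int (s * x * y / of_nat p)" if "y \<in> F \<inter> P" for y
  proof -
    have "s = t y * prod t (F \<inter> P - {y})" unfolding s_def using F(1) that by (intro prod.remove) auto
    then have eq: "s * x * y / of_nat p = t y * (x * y) / of_nat p * prod t (F \<inter> P - {y})" by simp
    show ?thesis unfolding eq using t[OF that] t_prod[of "F \<inter> P - {y}"] by (intro algebraic_int_mult) blast+
  qed
  have "algebraic_int (s * x * y / of_nat p)" if y: "y \<in> P" for y
  proof -
    obtain r where r: "r \<in> F" "algebraic_int ((y - r) / of_nat p)" using F(2) prime_algebraic_int[OF y] by blast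
    have "r \<in> P" using prime_diff[OF y algebraic_int_div_p_in_prime[OF r(2)]] by simp
    have eq: "s * x * y / of_nat p = s * x * ((y - r) / of_nat p) + s * x * r / of_nat p"
      by (simp add: right_diff_distrib diff_divide_distrib)
    have "algebraic_int (s * x * r / of_nat p)" using F' \<open>r \<in> P\<close> r(1) by blast
    then show ?thesis unfolding eq by (intro algebraic_int_add algebraic_int_mult s x(1) r(2))
  qed
  then show ?thesis using algebraic_int_mult[OF s(1) x(1)] x(2)[OF s] by blast
qed

text \<open>
  If \<open>p c\<^sup>i\<close> and \<open>p c\<^sup>j\<close> agree modulo \<open>pO\<close>, then \<open>c\<^sup>j - c\<^sup>i\<close> is integral, and \<open>c\<close> satisfies a
  monic equation over \<open>O\<close>.
\<close>

lemma almost_integral_imp_integral: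
  assumes "\<And>n. algebraic_int (of_nat p * c ^ n :: 'k)"
  shows "algebraic_int c"
proof -
  obtain i j where ij: "i < j" "algebraic_int ((of_nat p * c ^ j - of_nat p * c ^ i) / of_nat p)"
    using pigeonhole_mod_p[of "\<lambda>i. of_nat p * c ^ i"] assms by blast
  let ?f = "monom 1 j - monom 1 i :: 'k poly"
  have deg: "degree ?f = j"
    using ij(1) by (intro antisym degree_le le_degree) (auto simp: coeff_monom)
  show ?thesis
  proof (rule algebraic_int_root)
    show "algebraic_int (c ^ j - c ^ i)" using ij(2) p_nonzero by (simp flip: right_diff_distrib)
    show "poly ?f c = c ^ j - c ^ i" by (simp add: poly_monom)
    show "lead_coeff ?f = 1" "degree ?f > 0" unfolding deg using ij(1) by (simp_all add: coeff_monom)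
    show "\<forall>i. coeff ?f i \<in> \<int>" by (simp add: coeff_monom)
  qed
qed

text \<open>
  With \<open>b\<close> annihilating \<open>P\<close> modulo \<open>p\<close>, the fraction \<open>c = b/p\<close> plays the role of an element of the
  inverse ideal of \<open>P\<close>. It cannot preserve \<open>P\<close>, being non-integral, so some \<open>s = c u\<close> with
  \<open>u \<in> P\<close> is prime to \<open>P\<close>. For \<open>x \<in> P\<close> the quotient \<open>s x / u = c x\<close> is integral.
\<close>

lemma ex_local_generator:
  "\<exists>u s. u \<in> P \<and> u \<noteq> 0 \<and> algebraic_int s \<and> s \<notin> P \<and> (\<forall>x\<in>P. algebraic_int (s * x / u))"
proof -
  obtain b where b: "algebraic_int b" "\<not> algebraic_int (b / of_nat p)"
      "\<And>y. y \<in> P \<Longrightarrow> algebraic_int (b * y / of_nat p)"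
    using ex_annihilator_mod_p by blast
  define c where "c = b / of_nat p"
  have c: "algebraic_int (c * y)" if "y \<in> P" for y using b(3)[OF that] by (simp add: c_def)
  have "\<exists>u\<in>P. c * u \<notin> P"
  proof (rule ccontr)
    assume "\<not> (\<exists>u\<in>P. c * u \<notin> P)"
    then have "of_nat p * c ^ n \<in> P" for n
      by (induction n) (auto simp: prime_below mult_ac)
    then have "algebraic_int c" by (rule almost_integral_imp_integral[OF prime_algebraic_int])
    then show False using b(2) by (simp add: c_def)
  qed
  then obtain u where u: "u \<in> P" "c * u \<notin> P" by blast
  have "u \<noteq> 0" using u prime_zero by auto
  moreover have "algebraic_int (c * u * x / u)" if "x \<in> P" for x
    using c[OF that] \<open>u \<noteq> 0\<close> by simp
  ultimately show ?thesis using u c by blast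
qed

definition local_ring :: "'k set" where
  "local_ring = {a / b | a b. algebraic_int a \<and> algebraic_int b \<and> b \<notin> P}"

definition local_max :: "'k set" where
  "local_max = {a / b | a b. a \<in> P \<and> algebraic_int b \<and> b \<notin> P}"

lemma denominator_nonzero: "b \<notin> P \<Longrightarrow> b \<noteq> 0"
  using prime_zero by auto

lemma local_ringI: "algebraic_int a \<Longrightarrow> algebraic_int b \<Longrightarrow> b \<notin> P \<Longrightarrow> a / b \<in> local_ring"
  unfolding local_ring_def by blast

lemma local_maxI: "a \<in> P \<Longrightarrow> algebraic_int b \<Longrightarrow> b \<notin> P \<Longrightarrow> a / b \<in> local_max"
  unfolding local_max_def by blast

lemma local_ringE:
  assumes "x \<in> local_ring"
  obtains a b where "algebraic_int a" "algebraic_int b" "b \<notin> P" "b \<noteq> 0" "x = a / b"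
  using assms denominator_nonzero unfolding local_ring_def by blast

lemma local_maxE:
  assumes "x \<in> local_max"
  obtains a b where "a \<in> P" "algebraic_int b" "b \<notin> P" "b \<noteq> 0" "x = a / b"
  using assms denominator_nonzero unfolding local_max_def by blast

lemma algebraic_int_local: "algebraic_int x \<Longrightarrow> x \<in> local_ring"
  using local_ringI[of x 1] one_notin_prime by simp

lemma prime_local: "x \<in> P \<Longrightarrow> x \<in> local_max"
  using local_maxI[of x 1] one_notin_prime by simp

lemma local_add: "x \<in> local_ring \<Longrightarrow> y \<in> local_ring \<Longrightarrow> x + y \<in> local_ring"
  by (elim local_ringE) (auto simp: add_frac_eq mult_in_prime_iff intro!: local_ringI algebraic_int_add algebraic_int_mult)

lemma local_mult: "x \<in> local_ring \<Longrightarrow> y \<in> local_ring \<Longrightarrow> x * y \<in> local_ring"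
  by (elim local_ringE) (auto simp: mult_in_prime_iff intro!: local_ringI algebraic_int_mult)

lemma local_power: "x \<in> local_ring \<Longrightarrow> x ^ n \<in> local_ring"
  by (induction n) (auto intro: local_mult algebraic_int_local)

lemma local_max_add: "x \<in> local_max \<Longrightarrow> y \<in> local_max \<Longrightarrow> x + y \<in> local_max"
  by (elim local_maxE) (auto simp: add_frac_eq mult_in_prime_iff prime_algebraic_int intro!: local_maxI prime_add algebraic_int_mult)

lemma local_max_mult: "x \<in> local_max \<Longrightarrow> y \<in> local_ring \<Longrightarrow> x * y \<in> local_max"
  by (elim local_maxE local_ringE) (auto simp: mult_in_prime_iff prime_algebraic_int intro!: local_maxI algebraic_int_mult)

lemma algebraic_int_in_local_max:
  assumes "algebraic_int x" "x \<in> local_max"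
  shows "x \<in> P"
proof -
  obtain a b where ab: "a \<in> P" "algebraic_int b" "b \<notin> P" "b \<noteq> 0" "x = a / b"
    using assms by (elim local_maxE) blast
  then have "x * b \<in> P" by simp
  then show ?thesis using notin_prime_mult[of x b] ab assms by auto
qed

lemma one_notin_local_max: "1 \<notin> local_max"
  using algebraic_int_in_local_max one_notin_prime by auto

lemma local_inverse:
  assumes "x \<in> local_ring" "x \<notin> local_max"
  shows "inverse x \<in> local_ring"
proof -
  obtain a b where ab: "algebraic_int a" "algebraic_int b" "b \<notin> P" "b \<noteq> 0" "x = a / b"
    using assms by (elim local_ringE) blast
  then have "a \<notin> P" using assms local_maxI by auto
  then show ?thesis using ab local_ringI[of b a] by simp
qed

definition uniformizer :: "'k \<Rightarrow> bool" where
  "uniformizer u \<longleftrightarrow> u \<noteq> 0 \<and> u \<in> P \<and> (\<forall>x\<in>local_max. x / u \<in> local_ring)"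

lemma ex_uniformizer: "\<exists>u. uniformizer u"
proof -
  obtain u s where us: "u \<in> P" "u \<noteq> 0" "algebraic_int s" "s \<notin> P" "\<And>x. x \<in> P \<Longrightarrow> algebraic_int (s * x / u)"
    using ex_local_generator by blast
  have "x / u \<in> local_ring" if x: "x \<in> local_max" for x
  proof -
    obtain a b where ab: "a \<in> P" "algebraic_int b" "b \<notin> P" "b \<noteq> 0" "x = a / b"
      using x by (elim local_maxE) blast
    have "s \<noteq> 0" using us denominator_nonzero by blast
    then have eq: "x / u = (s * a / u) / (s * b)" using ab by simp
    show ?thesis unfolding eq
      by (intro local_ringI notin_prime_mult algebraic_int_mult us(3-5) ab(1-3))
  qed
  then show ?thesis using us by (auto simp: uniformizer_def)
qed

lemma uniformizer_power_p:
  assumes "uniformizer u"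
  shows "\<exists>e. u ^ e / of_nat p \<in> local_ring"
proof -
  have "u \<in> P" using assms by (simp add: uniformizer_def)
  then obtain e s where s: "algebraic_int s" "s \<notin> P" "algebraic_int (s * u ^ e / of_nat p)"
    using prime_power_divisible_by_p by blast
  have "u ^ e / of_nat p = (s * u ^ e / of_nat p) / s" using denominator_nonzero[OF s(2)] by simp
  then show ?thesis using local_ringI[OF s(3,1,2)] by auto
qed

lemma inverse_p_notin_local: "1 / of_nat p \<notin> local_ring"
proof
  assume "1 / of_nat p \<in> local_ring"
  then have "of_nat p * (1 / of_nat p) \<in> local_max" by (rule local_max_mult[OF prime_local[OF prime_below(2)]])
  then show False using one_notin_local_max p_nonzero by simp
qed

text \<open>
  Passing to a nonzero integer multiple \<open>N = p\<^sup>k N'\<close> of \<open>x\<close>, it suffices to bound powers of \<open>u\<close>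
  dividing \<open>N\<close>. Since some \<open>u\<^sup>e\<close> is divisible by \<open>p\<close>, divisibility by \<open>u\<close> to the power
  \<open>e (k + 1)\<close> would give divisibility of \<open>N'\<close> by \<open>p\<close>.
\<close>

lemma local_ring_archimedean:
  assumes "uniformizer u" "algebraic_int x" "x \<noteq> 0"
  shows "\<exists>n. \<forall>m\<ge>n. x / u ^ m \<notin> local_ring"
proof -
  obtain e where e: "u ^ e / of_nat p \<in> local_ring" using uniformizer_power_p assms by blast
  have u: "u \<noteq> 0" "algebraic_int u" using assms prime_algebraic_int by (auto simp: uniformizer_def)
  obtain N y where N: "N \<noteq> 0" "algebraic_int y" "of_int N = x * y"
    using algebraic_int_dvd_integer assms by blast
  define k where "k = multiplicity (int p) N"
  have pp: "\<not> is_unit (int p)" using prime_below(1) by (metis not_prime_unit prime_nat_int_transfer)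
  obtain N' where N': "N = int p ^ k * N'" "\<not> int p dvd N'"
    using multiplicity_decompose'[of N "int p"] N(1) pp unfolding k_def by metis
  have "x / u ^ m \<notin> local_ring" if m: "m \<ge> e * Suc k" for m
  proof
    assume xm: "x / u ^ m \<in> local_ring"
    have mm: "u ^ m = (u ^ e) ^ Suc k * u ^ (m - e * Suc k)"
      using m by (metis le_add_diff_inverse power_add power_mult)
    have Nk: "of_int N = of_nat p ^ k * (of_int N' :: 'k)" by (simp add: N'(1))
    have "x / u ^ m * y * (u ^ e / of_nat p) ^ Suc k * u ^ (m - e * Suc k) = of_int N / of_nat p ^ Suc k"
      using u unfolding N(3) mm by (simp add: power_divide field_simps)
    also have "\<dots> = of_int N' * (1 / of_nat p)" unfolding Nk using p_nonzero by simp
    finally have "of_int N' * (1 / of_nat p) \<in> local_ring"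
      using xm e N(2) u by (metis local_mult local_power algebraic_int_local)
    moreover have "of_int N' \<notin> local_max"
      using N'(2) of_int_in_prime_iff algebraic_int_in_local_max by auto
    then have "inverse (of_int N') \<in> local_ring" "of_int N' \<noteq> (0 :: 'k)"
      using local_inverse algebraic_int_local N' by auto
    ultimately have "inverse (of_int N') * (of_int N' * (1 / of_nat p)) \<in> local_ring" by (metis local_mult)
    then have "1 / of_nat p \<in> local_ring" using \<open>of_int N' \<noteq> 0\<close> by (simp add: mult.assoc[symmetric])
    then show False using inverse_p_notin_local by simp
  qed
  then show ?thesis by blast
qed

lemma algebraic_int_factorization:
  assumes "uniformizer u" "algebraic_int x" "x \<noteq> 0"
  shows "\<exists>n w. w \<in> local_ring - local_max \<and> x = u ^ n * w"
proof -
  have u: "u \<noteq> 0" "\<And>x. x \<in> local_max \<Longrightarrow> x / u \<in> local_ring" using assms by (auto simp: uniformizer_def)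
  obtain m where m: "x / u ^ m \<notin> local_ring" using local_ring_archimedean[OF assms] by blast
  moreover have "x / u ^ 0 \<in> local_ring" using assms algebraic_int_local by simp
  ultimately obtain n where n: "x / u ^ n \<in> local_ring" "x / u ^ Suc n \<notin> local_ring"
    using ex_least_nat_less[of "\<lambda>n. x / u ^ n \<notin> local_ring" m] by blast
  have "x / u ^ n \<notin> local_max" using u(2)[of "x / u ^ n"] n(2) by (auto simp: mult.commute)
  then show ?thesis using n u by (intro exI[of _ n] exI[of _ "x / u ^ n"]) auto
qed

text \<open>
  Writing \<open>x\<close> as a quotient of integers and factoring each as a power of the uniformizer times a
  unit decides which of \<open>x\<close> and \<open>1/x\<close> is local.
\<close>

sublocale local: valuation_subring local_ring local_max
proof
  show "local_max \<subseteq> local_ring" by (auto elim!: local_maxE intro: local_ringI prime_algebraic_int)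
  show "- x \<in> local_ring" if "x \<in> local_ring" for x
    using local_mult[OF that algebraic_int_local, of "- 1"] by simp
  fix x assume x: "x \<notin> local_ring"
  obtain u where u: "uniformizer u" using ex_uniformizer by blast
  then have u': "u \<noteq> 0" "u \<in> local_max" "algebraic_int u"
    using prime_local prime_algebraic_int by (auto simp: uniformizer_def)
  obtain a b where ab: "algebraic_int a" "algebraic_int b" "b \<noteq> 0" "x = a / b"
    using fraction_of_algebraic_ints by blast
  have "a \<noteq> 0" using ab x algebraic_int_local[of 0] by auto
  obtain i w where w: "w \<in> local_ring" "w \<notin> local_max" "a = u ^ i * w"
    using algebraic_int_factorization[OF u ab(1) \<open>a \<noteq> 0\<close>] by auto
  obtain j w' where w': "w' \<in> local_ring" "w' \<notin> local_max" "b = u ^ j * w'"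
    using algebraic_int_factorization[OF u ab(2,3)] by auto
  show "inverse x \<in> local_max"
  proof (cases "i < j")
    case True
    then obtain k where k: "j = i + Suc k" using less_imp_Suc_add by auto
    have "inverse x = u * (u ^ k * w' * inverse w)"
      using u'(1) by (simp add: ab w w' k power_add field_simps)
    also have "\<dots> \<in> local_max"
      using u' w w' by (intro local_max_mult local_mult local_power local_inverse) (auto intro: algebraic_int_local)
    finally show ?thesis .
  next
    case False
    then obtain k where k: "i = j + k" using le_Suc_ex by (metis not_le)
    have "x = u ^ k * w * inverse w'"
      using u'(1) by (simp add: ab w w' k power_add field_simps)
    also have "\<dots> \<in> local_ring"
      using u' w w' by (intro local_mult local_power local_inverse) (auto intro: algebraic_int_local)
    finally show ?thesis using x by simp
  qed
qed (simp_all add: algebraic_int_local local_add local_mult prime_local prime_zero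
    local_max_add local_max_mult one_notin_local_max local_inverse)

section \<open>The valuation\<close>

lemma field_factorization:
  assumes "uniformizer u" "x \<noteq> 0"
  shows "\<exists>k w. w \<in> local_ring - local_max \<and> x = u powi k * w"
proof -
  obtain a b where ab: "algebraic_int a" "algebraic_int b" "b \<noteq> 0" "x = a / b"
    using fraction_of_algebraic_ints by blast
  have "a \<noteq> 0" using ab assms by auto
  have "u \<noteq> 0" using assms by (auto simp: uniformizer_def)
  obtain i w where w: "w \<in> local_ring - local_max" "a = u ^ i * w"
    using algebraic_int_factorization[OF assms(1) ab(1) \<open>a \<noteq> 0\<close>] by auto
  obtain j w' where w': "w' \<in> local_ring - local_max" "b = u ^ j * w'"
    using algebraic_int_factorization[OF assms(1) ab(2,3)] by auto
  have "x = u powi (int i - int j) * (w * inverse w')"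
    using \<open>u \<noteq> 0\<close> by (simp add: ab w w' power_int_diff field_simps)
  then show ?thesis using local.unit_mult[OF w(1) local.unit_inverse[OF w'(1)]] by blast
qed

lemma powi_unit_in_local_max:
  assumes "uniformizer u" "w \<in> local_ring - local_max" "k > 0"
  shows "u powi k * w \<in> local_max"
proof -
  have u: "u \<in> local_max" using assms prime_local by (auto simp: uniformizer_def)
  obtain n where n: "k = int (Suc n)" using assms(3) by (metis gr0_implies_Suc zero_less_imp_eq_int of_nat_0_less_iff)
  have "u powi k * w = u * (u ^ n * w)" unfolding n power_int_of_nat by simp
  also have "\<dots> \<in> local_max"
    using u assms(2) local.max_subset by (intro local_max_mult local_mult local_power) auto
  finally show ?thesis .
qed

lemma powi_unit_local_iff:
  assumes "uniformizer u" "w \<in> local_ring - local_max"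
  shows "u powi k * w \<in> local_ring \<longleftrightarrow> k \<ge> 0" "u powi k * w \<in> local_max \<longleftrightarrow> k > 0"
proof -
  have neg: "u powi k * w \<notin> local_ring" if "k < 0"
  proof
    assume R: "u powi k * w \<in> local_ring"
    have "u powi (- k) * inverse w \<in> local_max"
      using powi_unit_in_local_max[OF assms(1) local.unit_inverse[OF assms(2)]] that by simp
    then have "u powi (- k) * inverse w * (u powi k * w) \<in> local_max" using R by (rule local_max_mult)
    moreover have "u \<noteq> 0" "w \<noteq> 0" using assms local.max_zero by (auto simp: uniformizer_def)
    ultimately show False using one_notin_local_max by (simp add: power_int_minus field_simps)
  qed
  have pos: "u powi k * w \<in> local_max" if "k > 0" using powi_unit_in_local_max assms that by blast
  show "u powi k * w \<in> local_ring \<longleftrightarrow> k \<ge> 0" "u powi k * w \<in> local_max \<longleftrightarrow> k > 0"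
    using neg pos assms(2) local.max_subset
    by (cases k "0 :: int" rule: linorder_cases; auto)+
qed

lemma powi_unit_unique:
  assumes u: "uniformizer u" and w: "w \<in> local_ring - local_max" "w' \<in> local_ring - local_max"
    and eq: "u powi k * w = u powi l * w'"
  shows "k = l"
proof -
  have "u \<noteq> 0" using u by (simp add: uniformizer_def)
  have "\<not> a < b" if "v \<in> local_ring - local_max" "v' \<in> local_ring - local_max" "u powi a * v = u powi b * v'" for a b v v'
  proof
    assume "a < b"
    have "v = u powi (b - a) * v'" using that(3) \<open>u \<noteq> 0\<close> by (simp add: power_int_diff field_simps)
    then show False using that powi_unit_local_iff(2)[OF u that(2), of "b - a"] \<open>a < b\<close> by auto
  qed
  then show ?thesis using w eq by (metis linorder_neqE)
qed

text \<open>
  The ideal powers of \<open>P\<close> are the contractions of the powers of \<open>u\<close>. From left to right this is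
  an induction over sums of products. Conversely, \<open>b x = u\<^sup>n a\<close> lies in the \<open>n\<close>-th power for some
  \<open>b\<close> prime to \<open>P\<close>, and \<open>b\<close> is invertible modulo every power of \<open>P\<close>.
\<close>

lemma ideal_power_iff:
  assumes u: "uniformizer u"
  shows "x \<in> P [^]\<^bsub>ideals_set \<O>\<^esub> (n::nat) \<longleftrightarrow> algebraic_int x \<and> x / u ^ n \<in> local_ring"
proof -
  have u': "u \<noteq> 0" "u \<in> P" "\<And>x. x \<in> local_max \<Longrightarrow> x / u \<in> local_ring" using u by (auto simp: uniformizer_def)
  let ?P = "\<lambda>n::nat. P [^]\<^bsub>ideals_set \<O>\<^esub> n"
  have P0: "?P 0 = {x. algebraic_int x}" by (simp add: ideals_set_def ring_of_integers_simps)
  have PS: "?P (Suc n) = ideal_prod \<O> (?P n) P" for n by (simp add: ideals_set_def)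
  have id: "ideal (?P n) \<O>" for n
  proof (induction n)
    case 0
    then show ?case using oneideal by (simp add: ideals_set_def)
  next
    case (Suc n)
    then show ?case unfolding PS using ideal_prod_is_ideal is_ideal by blast
  qed
  have add: "x + y \<in> ?P n" if "x \<in> ?P n" "y \<in> ?P n" for x y n
    using additive_subgroup.a_closed[OF ideal.axioms(1)[OF id] that] by (simp add: ring_of_integers_simps)
  have mult: "x * y \<in> ?P n" if "x \<in> ?P n" "algebraic_int y" for x y n
    using ideal.I_r_closed[OF id that(1), of y] that(2) by (simp add: ring_of_integers_simps)
  have prod: "x * y \<in> ?P (Suc n)" if "x \<in> ?P n" "y \<in> P" for x y n
    using ideal_prod.prod[OF that, of \<O>] unfolding PS by (simp add: ring_of_integers_simps)
  have sub: "algebraic_int x \<and> x / u ^ n \<in> local_ring" if "x \<in> ?P n" for x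
    using that
  proof (induction n arbitrary: x)
    case 0
    then have "algebraic_int x" by (simp only: P0 mem_Collect_eq)
    then show ?case using algebraic_int_local by simp
  next
    case (Suc n)
    then have "x \<in> ideal_prod \<O> (?P n) P" by (simp only: PS)
    then show ?case
    proof (induction rule: ideal_prod.induct)
      case (prod i j)
      have "i / u ^ n * (j / u) \<in> local_ring"
        using Suc.IH[OF prod(1)] u'(3) prime_local prod(2) by (intro local_mult) auto
      then show ?case using Suc.IH[OF prod(1)] prime_algebraic_int[OF prod(2)] algebraic_int_mult
        by (simp add: ring_of_integers_simps mult.commute)
    next
      case (sum s t)
      then show ?case by (auto simp: ring_of_integers_simps add_divide_distrib intro: algebraic_int_add local_add)
    qed
  qed
  have un: "u ^ n \<in> ?P n" for n
  proof (induction n)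
    case (Suc n)
    then show ?case using prod[OF Suc u'(2)] by (simp add: mult.commute)
  qed (simp only: P0, simp)
  have inv: "\<exists>t. algebraic_int t \<and> 1 - s * t \<in> ?P n" if s: "algebraic_int s" "s \<notin> P" for s n
  proof (induction n)
    case 0
    show ?case by (intro exI[of _ 0]) (simp only: P0, simp)
  next
    case (Suc n)
    then obtain t where t: "algebraic_int t" "1 - s * t \<in> ?P n" by blast
    obtain t' where t': "algebraic_int t'" "1 - s * t' \<in> P" using inverse_mod_prime[OF s] by blast
    have "(1 - s * t) * (1 - s * t') = 1 - s * (t + t' - s * t * t')" by (simp add: algebra_simps)
    then show ?case using prod[OF t(2) t'(2)] t t' s
      by (intro exI[of _ "t + t' - s * t * t'"]) (auto intro!: algebraic_int_add algebraic_int_diff algebraic_int_mult)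
  qed
  have "x \<in> ?P n" if x: "algebraic_int x" "x / u ^ n \<in> local_ring"
  proof -
    obtain a b where ab: "algebraic_int a" "algebraic_int b" "b \<notin> P" "b \<noteq> 0" "x / u ^ n = a / b"
      using x(2) by (elim local_ringE) blast
    have bx: "b * x = u ^ n * a" using ab(4,5) u'(1) by (simp add: field_simps)
    obtain t where t: "algebraic_int t" "1 - b * t \<in> ?P n" using inv[OF ab(2,3)] by blast
    have "x = (1 - b * t) * x + b * x * t" by (simp add: algebra_simps)
    also have "\<dots> \<in> ?P n" unfolding bx by (intro add mult t x ab un)
    finally show ?thesis .
  qed
  then show ?thesis using sub by blast
qed

lemma ideal_multiplicity_eq:
  assumes u: "uniformizer u" and w: "w \<in> local_ring - local_max" and x: "algebraic_int (u ^ n * w)"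
  shows "ideal_multiplicity P (u ^ n * w) = n"
proof -
  have "u \<noteq> 0" using u by (simp add: uniformizer_def)
  have "u ^ n * w / u ^ m = u powi (int n - int m) * w" for m
    using \<open>u \<noteq> 0\<close> by (simp add: power_int_diff)
  then have "u ^ n * w / u ^ m \<in> local_ring \<longleftrightarrow> m \<le> n" for m
    using powi_unit_local_iff(1)[OF u w, of "int n - int m"] by simp
  then have "u ^ n * w \<in> P [^]\<^bsub>ideals_set \<O>\<^esub> m \<longleftrightarrow> m \<le> n" for m
    unfolding ideal_power_iff[OF u] using x by blast
  then show ?thesis unfolding ideal_multiplicity_def by (intro Greatest_equality) auto
qed

text \<open>
  All representations of an element as a quotient of integers give the same difference of
  multiplicities, because the exponent of the uniformizer is unique.
\<close>

lemma valuation_eq: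
  assumes u: "uniformizer u" and w: "w \<in> local_ring - local_max"
  shows "valuation P (u powi k * w) = Fin k"
proof -
  let ?x = "u powi k * w"
  have "u \<noteq> 0" "w \<noteq> 0" using assms local.max_zero by (auto simp: uniformizer_def)
  then have "?x \<noteq> 0" by simp
  have eq: "int (ideal_multiplicity P a) - int (ideal_multiplicity P b) = k"
    if ab: "algebraic_int a" "algebraic_int b" "b \<noteq> 0" "?x = a / b" for a b
  proof -
    have "a \<noteq> 0" using ab \<open>?x \<noteq> 0\<close> by auto
    obtain i v where v: "v \<in> local_ring - local_max" "a = u ^ i * v"
      using algebraic_int_factorization[OF u ab(1) \<open>a \<noteq> 0\<close>] by auto
    obtain j v' where v': "v' \<in> local_ring - local_max" "b = u ^ j * v'"
      using algebraic_int_factorization[OF u ab(2,3)] by auto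
    have "a / b = u powi (int i - int j) * (v * inverse v')"
      using \<open>u \<noteq> 0\<close> by (simp add: v v' power_int_diff field_simps)
    then have "?x = u powi (int i - int j) * (v * inverse v')" by (simp only: ab(4))
    then have "k = int i - int j"
      using powi_unit_unique[OF u w local.unit_mult[OF v(1) local.unit_inverse[OF v'(1)]]] by blast
    then show ?thesis using ideal_multiplicity_eq[OF u] ab v v' by simp
  qed
  moreover obtain a b where "algebraic_int a" "algebraic_int b" "b \<noteq> 0" "?x = a / b"
    using fraction_of_algebraic_ints by blast
  ultimately have "(THE m. \<exists>a b. algebraic_int a \<and> algebraic_int b \<and> b \<noteq> 0 \<and> ?x = a / b \<and>
      m = int (ideal_multiplicity P a) - int (ideal_multiplicity P b)) = k"
    by (intro the_equality) metis+
  then show ?thesis using \<open>?x \<noteq> 0\<close> by (simp only: valuation_def if_False)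
qed

lemma valuation_nonneg_iff: "valuation P x \<ge> 0 \<longleftrightarrow> x \<in> local_ring"
  and valuation_pos_iff: "valuation P x > 0 \<longleftrightarrow> x \<in> local_max"
proof -
  obtain u where u: "uniformizer u" using ex_uniformizer by blast
  have "(valuation P x \<ge> 0 \<longleftrightarrow> x \<in> local_ring) \<and> (valuation P x > 0 \<longleftrightarrow> x \<in> local_max)"
  proof (cases "x = 0")
    case True
    then show ?thesis using local.zero_mem local.max_zero
      by (simp add: valuation_def zero_extended_def less_extended_def)
  next
    case False
    then obtain k w where "w \<in> local_ring - local_max" "x = u powi k * w"
      using field_factorization[OF u] by blast
    then show ?thesis using powi_unit_local_iff[OF u] valuation_eq[OF u]
      by (simp add: zero_extended_def less_extended_def less_le_not_le)
  qed
  then show "valuation P x \<ge> 0 \<longleftrightarrow> x \<in> local_ring" "valuation P x > 0 \<longleftrightarrow> x \<in> local_max" by auto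
qed

section \<open>Reduction of periodic points\<close>

text \<open>
  Finiteness is recorded separately, because the cardinality of an infinite quotient would be zero.
\<close>

lemma ideal_norm_le: "finite (carrier (\<O> Quot P))" "ideal_norm P \<le> p ^ D"
proof -
  obtain F where F: "finite F" "card F \<le> p ^ D" "F \<subseteq> {a. algebraic_int a}"
      "\<And>y. algebraic_int y \<Longrightarrow> \<exists>r\<in>F. y - r \<in> P"
    using residues_bound[of P] prime_zero prime_add prime_mult prime_mult[OF prime_below(2)] by blast
  have sub: "carrier (\<O> Quot P) \<subseteq> (\<lambda>r. P +>\<^bsub>\<O>\<^esub> r) ` F"
  proof
    fix C assume "C \<in> carrier (\<O> Quot P)"
    then obtain y where y: "algebraic_int y" "C = P +>\<^bsub>\<O>\<^esub> y"
      by (auto simp: FactRing_def A_RCOSETS_def' ring_of_integers_simps)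
    obtain r where r: "r \<in> F" "y - r \<in> P" using F(4) y by blast
    have "y = (y - r) \<oplus>\<^bsub>\<O>\<^esub> r" by (simp add: ring_of_integers_simps)
    then have "y \<in> P +>\<^bsub>\<O>\<^esub> r" using r(2) by (auto simp: a_r_coset_def' )
    then have "C = P +>\<^bsub>\<O>\<^esub> r" using y a_repr_independence[OF _ _ a_subgroup, of y r] F(3) r
      by (auto simp: ring_of_integers_simps)
    then show "C \<in> (\<lambda>r. P +>\<^bsub>\<O>\<^esub> r) ` F" using r by blast
  qed
  then show "finite (carrier (\<O> Quot P))" using F(1) finite_surj by blast
  have "ideal_norm P \<le> card F" unfolding ideal_norm_def using surj_card_le[OF F(1) sub] .
  then show "ideal_norm P \<le> p ^ D" using F(2) by simp
qed

text \<open>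
  The map from \<open>O\<close> to the residue field of the local ring is onto, because a denominator can be
  replaced by an inverse modulo \<open>P\<close>.
\<close>

lemma local_ring_residue:
  assumes "x \<in> local_ring"
  shows "\<exists>r. algebraic_int r \<and> x - r \<in> local_max"
proof -
  obtain a b where ab: "algebraic_int a" "algebraic_int b" "b \<notin> P" "b \<noteq> 0" "x = a / b"
    using assms by (elim local_ringE) blast
  obtain t where t: "algebraic_int t" "1 - b * t \<in> P" using inverse_mod_prime ab by blast
  have "x - a * t = (1 - b * t) * a / b" using ab by (simp add: field_simps)
  then have "x - a * t \<in> local_max" using ab t by (auto intro!: local_maxI prime_mult)
  then show ?thesis using ab t algebraic_int_mult by blast
qed

lemma card_le_ideal_norm:
  assumes "S \<subseteq> local_ring" "\<And>x y. x \<in> S \<Longrightarrow> y \<in> S \<Longrightarrow> x - y \<in> local_max \<Longrightarrow> x = y"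
  shows "finite S" "card S \<le> ideal_norm P"
proof -
  obtain r where r: "\<And>x. x \<in> S \<Longrightarrow> algebraic_int (r x)" "\<And>x. x \<in> S \<Longrightarrow> x - r x \<in> local_max"
    using local_ring_residue assms(1) by (metis subsetD)
  let ?f = "\<lambda>x. P +>\<^bsub>\<O>\<^esub> r x"
  have "inj_on ?f S"
  proof (rule inj_onI)
    fix x y assume xy: "x \<in> S" "y \<in> S" "?f x = ?f y"
    have "r x = 0 \<oplus>\<^bsub>\<O>\<^esub> r x" by (simp add: ring_of_integers_simps)
    then have "r x \<in> ?f x" using prime_zero by (auto simp: a_r_coset_def')
    then have "r x \<in> ?f y" using xy by simp
    then obtain q where "q \<in> P" "r x = q + r y" by (auto simp: a_r_coset_def' ring_of_integers_simps)
    then have "r x - r y \<in> local_max" using prime_local by simp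
    then have "(x - r x) + (r x - r y) + - (y - r y) \<in> local_max"
      using r xy by (intro local_max_add local.max_minus)
    then show "x = y" using assms(2) xy by simp
  qed
  moreover have "?f ` S \<subseteq> carrier (\<O> Quot P)"
    using r(1) by (auto simp: FactRing_def A_RCOSETS_def' ring_of_integers_simps)
  ultimately show "finite S" "card S \<le> ideal_norm P"
    unfolding ideal_norm_def using ideal_norm_le(1) by (meson finite_imageD finite_subset, metis card_inj_on_le)
qed

lemma inseparable_polynomial_if_good_reduction:
  assumes "inseparable_good_reduction P \<phi>" "degree \<phi> \<ge> 2"
  shows "inseparable_polynomial local_ring local_max \<phi>"
proof
  show coeff: "coeff \<phi> i \<in> local_ring" for i
  proof (cases "i \<le> degree \<phi>")
    case True
    then show ?thesis using assms
      by (auto simp: inseparable_good_reduction_def good_reduction_def valuation_nonneg_iff)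
  next
    case False
    then show ?thesis using local.zero_mem by (simp add: coeff_eq_0)
  qed
  have "valuation P (lead_coeff \<phi>) = 0"
    using assms by (simp add: inseparable_good_reduction_def good_reduction_def)
  then show "lead_coeff \<phi> \<notin> local_max" by (simp add: valuation_pos_iff[symmetric])
  show "of_nat i * coeff \<phi> i \<in> local_max" for i
  proof (cases "p dvd i")
    case True
    then have "of_nat i \<in> local_max" using of_int_in_prime_iff[of "int i"] prime_local by simp
    then show ?thesis using coeff by (rule local_max_mult)
  next
    case False
    show ?thesis
    proof (cases "i \<le> degree \<phi>")
      case True
      then have "coeff \<phi> i \<in> local_max"
        using assms False by (simp add: inseparable_good_reduction_def valuation_pos_iff)
      then show ?thesis by (intro local.max_mult2 algebraic_int_local) auto
    qed (simp add: coeff_eq_0 local.max_zero)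
  qed
qed (rule assms)

text \<open>
  If \<open>p\<close> did not divide the degree, inseparability would put the leading coefficient into the
  maximal ideal, contrary to good reduction.
\<close>

lemma p_le_degree:
  assumes "inseparable_good_reduction P \<phi>" "degree \<phi> > 0"
  shows "p \<le> degree \<phi>"
proof -
  have "p dvd degree \<phi>"
    using assms(1) by (force simp: inseparable_good_reduction_def good_reduction_def)
  then show ?thesis using assms(2) by (rule dvd_imp_le)
qed

end

theorem theorem3:
  fixes d D :: nat
    and P :: "'k::field_char_0 set"
    and \<phi> :: "'k poly"
  assumes "d \<ge> 2" and "D \<ge> 1"
    and "number_field_of_degree TYPE('k) D"
    and "primeideal P (ring_of_integers :: 'k ring)" and "P \<noteq> {0}"
    and "Polynomial.degree \<phi> = d"
    and "inseparable_good_reduction P \<phi>"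
  shows "finite (Per \<phi>) \<and> card (Per \<phi>) \<le> ideal_norm P \<and> card (Per \<phi>) \<le> d ^ D"
proof -
  interpret number_field_prime P D using assms(3-5) by (rule number_field_prime.intro)
  interpret inseparable_polynomial local_ring local_max \<phi>
    using assms by (intro inseparable_polynomial_if_good_reduction) auto
  have fin: "finite (Per \<phi>)" and norm: "card (Per \<phi>) \<le> ideal_norm P"
    using card_le_ideal_norm[of "Per \<phi>"] periodic_integral periodic_congruent_imp_eq by blast+
  have "ideal_norm P \<le> p ^ D" by (rule ideal_norm_le)
  also have "\<dots> \<le> d ^ D" using p_le_degree[OF assms(7)] assms by (intro power_mono) auto
  finally show ?thesis using fin norm by simp
qed

end
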